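(* Let $n\ge 1$ and let $\phi,\psi\in M_n(L^\infty)$. Assume that $P(\overline z\,\phi(z))$ is regular. Then $T_\phi H_\psi=H_\psi T_\phi^*$ on $H^2_n$ if and only if there exists $A\in M_n(\mathbb{C})$ such that the following hold: (i) $\psi(z)-\phi(\overline z)A$ is analytic; (ii) $\psi(z)+A\phi^*(z)$ is analytic; (iii) $\phi(\overline z)A\phi(z)^*$ is analytic.
   Context: $L^2,L^\infty$ are the square-integrable and essentially bounded functions on the unit circle $\mathbb{T}$ (normalized Lebesgue measure); $H^2\subset L^2$ is the closed subspace of functions whose negative Fourier coefficients vanish. $M_n(L^\infty)$ is the set of $n\times n$ matrices with entries in $L^\infty$, regarded as matrix-valued functions on $\mathbb{T}$. $H^2_n=\bigoplus_1^n H^2$ is the $\mathbb{C}^n$-valued Hardy space. $P$ denotes the orthogonal projection of $L^2$ onto $H^2$, applied entrywise to vector- and matrix-valued functions. For $F\in M_n(L^\infty)$, the Toeplitz operator $T_F:H^2_n\to H^2_n$ is $T_F(h)(z)=P(F(z)h(z))$ and the Hankel operator $H_F:H^2_n\to H^2_n$ is $H_F(h)(z)=P(\overline z F(\overline z)h(\overline z))$. $F^*$ is the pointwise adjoint of $F$. A matrix-valued function on $\mathbb{T}$ is analytic if all its Fourier coefficients of negative index vanish. An $m\times m$ matrix-valued function with entries in $L^2$ is called regular if its $m$ column vectors are linearly independent in $L^2_m$, the space of $\mathbb{C}^m$-valued $L^2$ functions. *)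

theory Defs
  imports "HOL-Analysis.Analysis"
begin

text \<open>
  Functions on the unit circle are represented by total functions on the complex numbers of which
  only the values on the circle matter. Elements of the Lebesgue spaces are represented by
  functions rather than by equivalence classes; equality in these spaces is equality almost
  everywhere with respect to the measure \<open>circle\<close>.
\<close>

definition circle :: "complex measure" where
  "circle = distr (uniform_measure lborel {0..<2 * pi}) (restrict_space borel (sphere 0 1)) cis"

definition L2 :: "(complex \<Rightarrow> complex) set" where
  "L2 = {f \<in> borel_measurable circle. integrable circle (\<lambda>z. (cmod (f z))\<^sup>2)}"

definition Linf :: "(complex \<Rightarrow> complex) set" where
  "Linf = {f \<in> borel_measurable circle. \<exists>C. AE z in circle. cmod (f z) \<le> C}"

definition fourier_coeff :: "(complex \<Rightarrow> complex) \<Rightarrow> int \<Rightarrow> complex" where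
  "fourier_coeff f k = (LINT z|circle. f z * cnj (z powi k))"

definition H2 :: "(complex \<Rightarrow> complex) set" where
  "H2 = {f \<in> L2. \<forall>k<0. fourier_coeff f k = 0}"

definition L2_inner :: "(complex \<Rightarrow> complex) \<Rightarrow> (complex \<Rightarrow> complex) \<Rightarrow> complex" where
  "L2_inner f g = (LINT z|circle. f z * cnj (g z))"

text \<open>The orthogonal projection of \<open>L2\<close> onto \<open>H2\<close>; the chosen representative is determined only
  up to a null set, and the value is meaningful only for arguments in \<open>L2\<close>.\<close>

definition proj_H2 :: "(complex \<Rightarrow> complex) \<Rightarrow> complex \<Rightarrow> complex" where
  "proj_H2 f = (SOME g. g \<in> H2 \<and> (\<forall>h\<in>H2. L2_inner (\<lambda>z. f z - g z) h = 0))"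

definition proj_vec :: "(complex \<Rightarrow> complex^'n) \<Rightarrow> complex \<Rightarrow> complex^'n" where
  "proj_vec f z = (\<chi> i. proj_H2 (\<lambda>w. f w $ i) z)"

definition proj_mat :: "(complex \<Rightarrow> complex^'n^'m) \<Rightarrow> complex \<Rightarrow> complex^'n^'m" where
  "proj_mat F z = (\<chi> i j. proj_H2 (\<lambda>w. F w $ i $ j) z)"

definition H2_vec :: "(complex \<Rightarrow> complex^'n) set" where
  "H2_vec = {h. \<forall>i. (\<lambda>z. h z $ i) \<in> H2}"

definition L2_vec_inner :: "(complex \<Rightarrow> complex^'n) \<Rightarrow> (complex \<Rightarrow> complex^'n) \<Rightarrow> complex" where
  "L2_vec_inner f g = (\<Sum>i\<in>UNIV. L2_inner (\<lambda>z. f z $ i) (\<lambda>z. g z $ i))"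

definition Linf_mat :: "(complex \<Rightarrow> complex^'n^'m) set" where
  "Linf_mat = {F. \<forall>i j. (\<lambda>z. F z $ i $ j) \<in> Linf}"

definition conj_transpose :: "complex^'n^'m \<Rightarrow> complex^'m^'n" where
  "conj_transpose A = (\<chi> i j. cnj (A $ j $ i))"

definition scalar_mat :: "complex \<Rightarrow> complex^'n^'m \<Rightarrow> complex^'n^'m" where
  "scalar_mat c A = (\<chi> i j. c * A $ i $ j)"

definition toeplitz ::
    "(complex \<Rightarrow> complex^'n^'n) \<Rightarrow> (complex \<Rightarrow> complex^'n) \<Rightarrow> complex \<Rightarrow> complex^'n" where
  "toeplitz F h = proj_vec (\<lambda>z. F z *v h z)"

definition hankel ::
    "(complex \<Rightarrow> complex^'n^'n) \<Rightarrow> (complex \<Rightarrow> complex^'n) \<Rightarrow> complex \<Rightarrow> complex^'n" where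
  "hankel F h = proj_vec (\<lambda>z. cnj z *s (F (cnj z) *v h (cnj z)))"

text \<open>The Hilbert space adjoint of an operator on \<open>H2_vec\<close>; again each value is
  determined only up to a null set.\<close>

definition op_adjoint ::
    "((complex \<Rightarrow> complex^'n) \<Rightarrow> complex \<Rightarrow> complex^'n)
      \<Rightarrow> (complex \<Rightarrow> complex^'n) \<Rightarrow> complex \<Rightarrow> complex^'n" where
  "op_adjoint T h =
    (SOME k. k \<in> H2_vec \<and> (\<forall>g\<in>H2_vec. L2_vec_inner (T g) h = L2_vec_inner g k))"

text \<open>Integrability is required because the Bochner integral of a non-integrable function
  is \<open>0\<close>.\<close>

definition analytic_mat :: "(complex \<Rightarrow> complex^'n^'m) \<Rightarrow> bool" where
  "analytic_mat F \<longleftrightarrow> (\<forall>i j. integrable circle (\<lambda>z. F z $ i $ j) \<and>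
     (\<forall>k<0. fourier_coeff (\<lambda>z. F z $ i $ j) k = 0))"

text \<open>Linear independence of the columns as a family of elements of the vector-valued Lebesgue
  space, where a vanishing linear combination is one that vanishes almost everywhere.\<close>

definition regular_mat :: "(complex \<Rightarrow> complex^'m^'m) \<Rightarrow> bool" where
  "regular_mat F \<longleftrightarrow> (\<forall>i j. (\<lambda>z. F z $ i $ j) \<in> L2) \<and>
     (\<forall>c :: 'm \<Rightarrow> complex.
        (AE z in circle. (\<Sum>j\<in>UNIV. c j *s column j (F z)) = 0) \<longrightarrow> (\<forall>j. c j = 0))"

end

theory Submission
  imports Defs "HOL-Probability.Probability"
begin

text \<open>
  Write \<open>X\<^sub>k\<close> for the Fourier coefficients of a matrix function \<open>X\<close>. Comparing the intertwining
  relation on \<open>z\<^sup>j\<close> and \<open>z\<^sup>j\<^sup>+\<^sup>1\<close> makes all infinite sums cancel and leaves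
  \<open>\<phi>\<^sub>i\<^sub>+\<^sub>1 \<psi>\<^sub>-\<^sub>j\<^sub>-\<^sub>1 = - \<psi>\<^sub>-\<^sub>i\<^sub>-\<^sub>1 (\<phi>\<^sub>j\<^sub>+\<^sub>1)\<^sup>*\<close> for \<open>i, j \<ge> 0\<close>.
  Regularity says that the matrices \<open>\<phi>\<^sub>i\<^sub>+\<^sub>1\<close> have no common kernel vector, so finitely many of
  their rows form a left invertible matrix; cancelling it produces \<open>A\<close> with
  \<open>\<psi>\<^sub>-\<^sub>j\<^sub>-\<^sub>1 = - A (\<phi>\<^sub>j\<^sub>+\<^sub>1)\<^sup>*\<close> and \<open>\<psi>\<^sub>-\<^sub>i\<^sub>-\<^sub>1 = \<phi>\<^sub>i\<^sub>+\<^sub>1 A\<close>, which are conditions (ii) and (i).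

  Let \<open>J f(z) = cnj z f(cnj z)\<close>, so that \<open>H\<^sub>\<psi> h = P J (\<psi> h)\<close> and \<open>J P = (1 - P) J\<close>. Under (i) and
  (ii) one may replace \<open>\<psi>\<close> by \<open>\<phi>(cnj z) A\<close> or by \<open>- A \<phi>\<^sup>*\<close> inside a Hankel operator, and then
  \<open>H\<^sub>\<psi> T\<^sub>\<phi>\<^sup>* h - T\<^sub>\<phi> H\<^sub>\<psi> h = P \<phi> A (J P + P J) \<phi>\<^sup>* h = P J (\<phi>(cnj z) A \<phi>\<^sup>* h)\<close>,
  which vanishes for all \<open>h\<close> exactly under (iii).
\<close>

section \<open>The circle\<close>

lemma space_circle [simp]: "space circle = sphere 0 1"
  by (simp add: circle_def space_restrict_space)

lemma sets_circle [measurable_cong]: "sets circle = sets (restrict_space borel (sphere 0 1))"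
  by (simp add: circle_def)

lemma borel_measurable_circle_eq:
  "borel_measurable circle = borel_measurable (restrict_space borel (sphere 0 1))"
  by (rule measurable_cong_sets) (simp_all add: sets_circle)

lemma cis_measurable_borel: "cis \<in> borel_measurable borel"
  by (intro borel_measurable_continuous_onI continuous_intros)

lemma cis_measurable_circle:
  "cis \<in> measurable (uniform_measure lborel {0..<2 * pi}) (restrict_space borel (sphere 0 1))"
  by (rule measurable_restrict_space2)
     (use cis_measurable_borel in \<open>auto simp: measurable_def\<close>)

lemma emeasure_period: "emeasure lborel {0..<2 * pi} = ennreal (2 * pi)"
  by simp

lemma prob_space_circle: "prob_space circle"
  unfolding circle_def
  by (intro prob_space.prob_space_distr cis_measurable_circle prob_space_uniform_measure) auto

interpretation circle: prob_space circle
  by (rule prob_space_circle)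

lemma nn_integral_circle:
  assumes "f \<in> borel_measurable circle"
  shows "(\<integral>\<^sup>+z. f z \<partial>circle) = (\<integral>\<^sup>+t. f (cis t) * indicator {0..<2*pi} t \<partial>lborel) / ennreal (2*pi)"
proof -
  have m: "f \<in> borel_measurable (restrict_space borel (sphere 0 1))"
    using assms by (simp add: borel_measurable_circle_eq)
  have m2: "(\<lambda>t. f (cis t)) \<in> borel_measurable (uniform_measure lborel {0..<2 * pi})"
    using measurable_compose[OF cis_measurable_circle m] by simp
  then have m3: "(\<lambda>t. f (cis t)) \<in> borel_measurable lborel"
    by (simp add: measurable_def)
  show ?thesis
    unfolding circle_def
    by (subst nn_integral_distr[OF cis_measurable_circle])
       (use m in \<open>simp add: measurable_def\<close>, subst nn_integral_uniform_measure, use m3 in auto)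
qed

lemma borel_measurable_circle_continuous:
  "continuous_on (sphere 0 1) f \<Longrightarrow> f \<in> borel_measurable circle"
  using borel_measurable_continuous_on_restrict[of "sphere 0 1" f]
  by (simp add: borel_measurable_circle_eq)

section \<open>Invariance of the measure under complex conjugation\<close>

lemma cnj_measurable_circle [measurable]: "cnj \<in> measurable circle circle"
proof -
  have "cnj \<in> measurable (restrict_space borel (sphere 0 1)) (restrict_space borel (sphere 0 1))"
    by (rule measurable_restrict_space3)
       (auto intro!: borel_measurable_continuous_onI continuous_intros)
  then show ?thesis
    by (simp add: measurable_def sets_circle space_restrict_space)
qed

lemma measurable_circle_imp_cis:
  assumes "f \<in> borel_measurable circle"
  shows "(\<lambda>t. f (cis t)) \<in> borel_measurable borel"
proof -
  have "f \<in> borel_measurable (restrict_space borel (sphere 0 1))"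
    using assms by (simp add: borel_measurable_circle_eq)
  from measurable_compose[OF cis_measurable_circle this] show ?thesis
    by (simp add: measurable_def)
qed

text \<open>In the angle, conjugation is t -> 2 pi - t. This preserves Lebesgue measure and carries
  the half-open period to (0, 2 pi], which differs from it by two points.\<close>

lemma distr_circle_cnj: "distr circle circle cnj = circle"
proof (rule measure_eqI)
  fix A assume "A \<in> sets (distr circle circle cnj)"
  then have A: "A \<in> sets circle" by simp
  have m: "(\<lambda>z. indicator A z :: ennreal) \<in> borel_measurable circle" using A by measurable
  have m': "(\<lambda>z. indicator A (cnj z) :: ennreal) \<in> borel_measurable circle" using A by measurable
  note mm = measurable_circle_imp_cis[OF m] measurable_circle_imp_cis[OF m']
  have "emeasure (distr circle circle cnj) A = (\<integral>\<^sup>+z. indicator A (cnj z) \<partial>circle)"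
    using A by (simp add: nn_integral_distr flip: nn_integral_indicator)
  also have "\<dots> = (\<integral>\<^sup>+t. indicator A (cnj (cis t)) * indicator {0..<2*pi} t \<partial>lborel) / ennreal (2*pi)"
    by (rule nn_integral_circle[OF m'])
  also have "(\<integral>\<^sup>+t. indicator A (cnj (cis t)) * indicator {0..<2*pi} t \<partial>lborel) =
     (\<integral>\<^sup>+t. indicator A (cnj (cis (2*pi + (-1)*t))) * indicator {0..<2*pi} (2*pi + (-1)*t) \<partial>lborel)"
    by (subst nn_integral_real_affine[of _ "-1" "2*pi"]) (use mm in auto)
  also have "\<dots> = (\<integral>\<^sup>+t. indicator A (cis t) * indicator {0..<2*pi} t \<partial>lborel)"
  proof (rule nn_integral_cong_AE)
    have "cnj (cis (2*pi + (-1)*t)) = cis t" for t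
      by (simp add: complex_eq_iff cos_diff sin_diff)
    \<comment> \<open>At t = 0 and t = 2 pi exactly one of the two interval indicators is 1, so
      these points are discarded.\<close>
    moreover have "AE t in lborel. t \<noteq> 0" "AE t in lborel. t \<noteq> 2*pi"
      by (rule AE_lborel_singleton)+
    ultimately show "AE t in lborel. indicator A (cnj (cis (2*pi + (-1)*t))) * indicator {0..<2*pi}
      (2*pi + (-1)*t)
      = indicator A (cis t) * (indicator {0..<2*pi} t :: ennreal)"
      by (auto simp: indicator_def elim!: eventually_elim2)
  qed
  also have "\<dots> / ennreal (2*pi) = (\<integral>\<^sup>+z. indicator A z \<partial>circle)"
    by (rule nn_integral_circle[OF m, symmetric])
  finally show "emeasure (distr circle circle cnj) A = emeasure circle A"
    using A by simp
qed simp

lemma integral_circle_cnj: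
  fixes f :: "complex \<Rightarrow> complex"
  assumes "f \<in> borel_measurable circle"
  shows "(LINT z|circle. f (cnj z)) = (LINT z|circle. f z)"
  using integral_distr[OF cnj_measurable_circle assms] by (simp add: distr_circle_cnj)

lemma integrable_circle_cnj:
  fixes f :: "complex \<Rightarrow> 'a::{banach, second_countable_topology}"
  assumes "integrable circle f"
  shows "integrable circle (\<lambda>z. f (cnj z))"
  using integrable_distr[of cnj circle circle f] assms by (simp add: distr_circle_cnj)

lemma AE_circle_cnj:
  assumes "AE z in circle. Q z"
  shows "AE z in circle. Q (cnj z)"
proof -
  have "AE z in distr circle circle cnj. Q z" using assms by (subst distr_circle_cnj)
  then show ?thesis by (rule AE_distrD[OF cnj_measurable_circle])
qed

lemma powi_measurable_circle [measurable]: "(\<lambda>z. z powi k) \<in> borel_measurable circle"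
  by (rule borel_measurable_circle_continuous) (auto intro!: continuous_intros)

text \<open>For nonzero \<open>k\<close> the integrand has the antiderivative cis(k t) / (2 pi i k),
  whose values at 0 and 2 pi agree. Orthonormality of the powers of z rests on this.\<close>

lemma integral_circle_powi: "(LINT z|circle. z powi k) = (if k = 0 then 1 else 0)"
proof (cases "k = 0")
  case False
  have m: "(\<lambda>z::complex. z powi k) \<in> borel_measurable (restrict_space borel (sphere 0 1))"
    using powi_measurable_circle[of k] unfolding borel_measurable_circle_eq .
  have [measurable]: "(\<lambda>t. cis (real_of_int k * t)) \<in> borel_measurable borel"
    by (intro borel_measurable_continuous_onI continuous_intros)
  have pw: "cis t powi k = cis (real_of_int k * t)" for t by (simp add: cis_power_int)
  have "(LINT z|circle. z powi k)
    = (LINT t|uniform_measure lborel {0..<2 * pi}. cis (real_of_int k * t))"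
    unfolding circle_def by (subst integral_distr[OF cis_measurable_circle m]) (simp add: pw)
  also have "uniform_measure lborel {0..<2 * pi}
    = density lborel (\<lambda>t. ennreal (indicator {0..<2 * pi} t / (2*pi)))"
    unfolding uniform_measure_def emeasure_period
    by (rule density_cong) (auto simp: indicator_def divide_ennreal simp del: ennreal_1
      simp flip: ennreal_1)
  also have "(LINT t|\<dots>. cis (real_of_int k * t))
    = (LINT t|lborel. (indicator {0..<2 * pi} t / (2*pi)) *\<^sub>R cis (real_of_int k * t))"
    by (rule integral_density) auto
  \<comment> \<open>Closing the interval changes the integrand at one point only and gives the form
    required by the fundamental theorem of calculus.\<close>
  also have "\<dots> = (LINT t|lborel. indicator {0..2 * pi} t *\<^sub>R ((1 / (2*pi)) *\<^sub>R cis (real_of_int k * t)))"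
  proof (rule integral_cong_AE)
    show "AE t in lborel. (indicator {0..<2 * pi} t / (2*pi)) *\<^sub>R cis (real_of_int k * t)
      = indicator {0..2 * pi} t *\<^sub>R ((1 / (2*pi)) *\<^sub>R cis (real_of_int k * t))"
      using AE_lborel_singleton[of "2*pi"] by eventually_elim (auto simp: indicator_def)
  qed measurable
  also have "\<dots> = cis (real_of_int k * (2*pi)) / (2*pi*\<i>*k) - cis (real_of_int k * 0) / (2*pi*\<i>*k)"
  proof (rule integral_FTC_atLeastAtMost)
    fix t assume "0 \<le> t" "t \<le> 2*pi"
    have "((\<lambda>w. exp (\<i> * k * w) / (2*pi*\<i>*k)) has_field_derivative exp (\<i> * k * of_real t) / (2*pi))
      (at (of_real t))"
      using False by (auto intro!: derivative_eq_intros)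
    from has_vector_derivative_real_field[OF this]
    have "((\<lambda>t. cis (real_of_int k * t) / (2*pi*\<i>*k)) has_vector_derivative cis (real_of_int k * t)
      / (2*pi)) (at t within {0..2*pi})"
      by (simp add: cis_conv_exp mult.assoc)
    then show "((\<lambda>t. cis (real_of_int k * t) / (2*pi*\<i>*k)) has_vector_derivative (1 / (2*pi)) *\<^sub>R
      cis (real_of_int k * t)) (at t within {0..2*pi})"
      by (simp add: scaleR_conv_of_real)
  qed (auto intro!: continuous_intros)
  also have "\<dots> = 0"
    using cis_power_int[of "2*pi" k] by (simp add: cis_2pi)
  finally show ?thesis using False by simp
qed (use circle.prob_space in simp)

section \<open>Square-integrable functions on the circle\<close>

definition nsq :: "(complex \<Rightarrow> complex) \<Rightarrow> real" where
  "nsq f = (LINT z|circle. (cmod (f z))\<^sup>2)"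

lemma nsq_nonneg: "0 \<le> nsq f"
  by (simp add: nsq_def)

lemma L2D:
  assumes "f \<in> L2"
  shows L2_measurable: "f \<in> borel_measurable circle"
    and L2_integrable_sq: "integrable circle (\<lambda>z. (cmod (f z))\<^sup>2)"
  using assms by (auto simp: L2_def)

lemma L2_dominated:
  assumes "f \<in> borel_measurable circle" "integrable circle g" "AE z in circle. (cmod (f z))\<^sup>2 \<le> g z"
  shows "f \<in> L2"
proof -
  have "integrable circle (\<lambda>z. (cmod (f z))\<^sup>2)"
    by (rule Bochner_Integration.integrable_bound[OF assms(2)]) (use assms in auto)
  then show ?thesis using assms by (simp add: L2_def)
qed

section \<open>Closure properties of \<open>L2\<close> and \<open>Linf\<close>\<close>

lemma L2_add: assumes "f \<in> L2" "g \<in> L2" shows "(\<lambda>z. f z + g z) \<in> L2"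
proof (rule L2_dominated)
  note [measurable] = L2_measurable[OF assms(1)] L2_measurable[OF assms(2)]
  show "(\<lambda>z. f z + g z) \<in> borel_measurable circle" by measurable
  show "integrable circle (\<lambda>z. 2 * (cmod (f z))\<^sup>2 + 2 * (cmod (g z))\<^sup>2)"
    by (intro Bochner_Integration.integrable_add integrable_mult_right L2_integrable_sq assms)
  have "(cmod (a + b))\<^sup>2 \<le> 2 * (cmod a)\<^sup>2 + 2 * (cmod b)\<^sup>2" for a b :: complex
  proof -
    have "(cmod (a + b))\<^sup>2 \<le> (cmod a + cmod b)\<^sup>2"
      by (intro power_mono norm_triangle_ineq) simp
    moreover have "0 \<le> (cmod a - cmod b)\<^sup>2" by simp
    ultimately show ?thesis by (simp add: power2_eq_square algebra_simps)
  qed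
  then show "AE z in circle. (cmod (f z + g z))\<^sup>2 \<le> 2 * (cmod (f z))\<^sup>2 + 2 * (cmod (g z))\<^sup>2"
    by simp
qed

lemma Linf_mult_L2: assumes "a \<in> Linf" "f \<in> L2" shows "(\<lambda>z. a z * f z) \<in> L2"
proof -
  obtain C where C: "AE z in circle. cmod (a z) \<le> C" and [measurable]: "a \<in> borel_measurable circle"
    using assms by (auto simp: Linf_def)
  note [measurable] = L2_measurable[OF assms(2)]
  show ?thesis
  proof (rule L2_dominated)
    show "(\<lambda>z. a z * f z) \<in> borel_measurable circle" by measurable
    show "integrable circle (\<lambda>z. C\<^sup>2 * (cmod (f z))\<^sup>2)"
      using assms by (auto intro: L2_integrable_sq)
    show "AE z in circle. (cmod (a z * f z))\<^sup>2 \<le> C\<^sup>2 * (cmod (f z))\<^sup>2"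
      using C by eventually_elim (auto simp: norm_mult power_mult_distrib
        intro!: mult_right_mono power_mono)
  qed
qed

lemma Linf_const: "(\<lambda>z. c) \<in> Linf"
  by (auto simp: Linf_def)

lemma Linf_powi: "(\<lambda>z. z powi k) \<in> Linf"
proof -
  have "AE z in circle. cmod (z powi k) \<le> 1"
    by (rule AE_I2) (simp add: norm_power_int)
  then show ?thesis by (auto simp: Linf_def)
qed

lemma const_L2: "(\<lambda>z. c) \<in> L2"
  by (auto simp: L2_def circle.integrable_const)

lemma Linf_L2: "a \<in> Linf \<Longrightarrow> a \<in> L2"
  using Linf_mult_L2[OF _ const_L2, of a 1] by simp

lemma L2_scale: "f \<in> L2 \<Longrightarrow> (\<lambda>z. c * f z) \<in> L2"
  by (rule Linf_mult_L2[OF Linf_const])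

lemma L2_uminus: "f \<in> L2 \<Longrightarrow> (\<lambda>z. - f z) \<in> L2"
  using L2_scale[of f "-1"] by simp

lemma L2_diff: "f \<in> L2 \<Longrightarrow> g \<in> L2 \<Longrightarrow> (\<lambda>z. f z - g z) \<in> L2"
  using L2_add[OF _ L2_uminus] by fastforce

lemma L2_sum: "(\<And>i. i \<in> I \<Longrightarrow> f i \<in> L2) \<Longrightarrow> (\<lambda>z. \<Sum>i\<in>I. f i z) \<in> L2"
  by (induction I rule: infinite_finite_induct) (auto intro: L2_add const_L2)

lemma L2_cnj: "f \<in> L2 \<Longrightarrow> (\<lambda>z. cnj (f z)) \<in> L2"
  by (auto simp: L2_def intro: measurable_compose[OF _
    borel_measurable_continuous_onI[OF continuous_on_cnj[OF continuous_on_id]]])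

lemma Linf_cnj: "a \<in> Linf \<Longrightarrow> (\<lambda>z. cnj (a z)) \<in> Linf"
  by (auto simp: Linf_def intro: measurable_compose[OF _
    borel_measurable_continuous_onI[OF continuous_on_cnj[OF continuous_on_id]]])

lemma L2_reflect: "f \<in> L2 \<Longrightarrow> (\<lambda>z. f (cnj z)) \<in> L2"
  using integrable_circle_cnj[of "\<lambda>z. (cmod (f z))\<^sup>2"]
  by (auto simp: L2_def intro: measurable_compose[OF cnj_measurable_circle])

lemma Linf_reflect: "a \<in> Linf \<Longrightarrow> (\<lambda>z. a (cnj z)) \<in> Linf"
  using AE_circle_cnj[of "\<lambda>z. cmod (a z) \<le> _"]
  by (fastforce simp: Linf_def intro: measurable_compose[OF cnj_measurable_circle])

lemma Linf_mult: assumes "a \<in> Linf" "b \<in> Linf" shows "(\<lambda>z. a z * b z) \<in> Linf"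
proof -
  obtain C D where C: "AE z in circle. cmod (a z) \<le> C" "AE z in circle. cmod (b z) \<le> D"
    and [measurable]: "a \<in> borel_measurable circle" "b \<in> borel_measurable circle"
    using assms by (auto simp: Linf_def)
  have "AE z in circle. cmod (a z * b z) \<le> C * D"
    using C by eventually_elim (auto simp: norm_mult intro!: mult_mono
      intro: order_trans[OF norm_ge_zero])
  then show ?thesis by (auto simp: Linf_def)
qed

lemma Linf_add: assumes "a \<in> Linf" "b \<in> Linf" shows "(\<lambda>z. a z + b z) \<in> Linf"
proof -
  obtain C D where C: "AE z in circle. cmod (a z) \<le> C" "AE z in circle. cmod (b z) \<le> D"
    and [measurable]: "a \<in> borel_measurable circle" "b \<in> borel_measurable circle"
    using assms by (auto simp: Linf_def)
  have "AE z in circle. cmod (a z + b z) \<le> C + D"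
    using C by eventually_elim (auto intro: norm_triangle_le)
  then show ?thesis by (auto simp: Linf_def)
qed

lemma Linf_diff: "a \<in> Linf \<Longrightarrow> b \<in> Linf \<Longrightarrow> (\<lambda>z. a z - b z) \<in> Linf"
  using Linf_add[of a "\<lambda>z. -1 * b z"] Linf_mult[OF Linf_const[of "-1"], of b] by simp

lemma Linf_sum: "(\<And>i. i \<in> I \<Longrightarrow> a i \<in> Linf) \<Longrightarrow> (\<lambda>z. \<Sum>i\<in>I. a i z) \<in> Linf"
  by (induction I rule: infinite_finite_induct) (auto intro: Linf_add Linf_const)

text \<open>The inequality is first applied to the moduli with extended nonnegative integrals; its
  finite bound yields integrability of the product before any Bochner integral is estimated.\<close>

lemma Cauchy_Schwarz_L2:
  assumes "f \<in> L2" "g \<in> L2"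
  shows integrable_L2_mult: "integrable circle (\<lambda>z. f z * g z)"
    and integral_L2_mult_le: "(cmod (LINT z|circle. f z * g z))\<^sup>2 \<le> nsq f * nsq g"
proof -
  note [measurable] = L2_measurable[OF assms(1)] L2_measurable[OF assms(2)]
  have nn: "(\<integral>\<^sup>+z. (ennreal (cmod (h z)))\<^sup>2 \<partial>circle) = ennreal (nsq h)" if "h \<in> L2" for h
    using nn_integral_eq_integral[OF L2_integrable_sq[OF that]] by (simp add: nsq_def ennreal_power)
  have cs: "(\<integral>\<^sup>+z. ennreal (cmod (f z * g z)) \<partial>circle)\<^sup>2 \<le> ennreal (nsq f * nsq g)"
    using Cauchy_Schwarz_nn_integral[of "\<lambda>z. ennreal (cmod (f z))" circle "\<lambda>z. ennreal (cmod (g z))"]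
    by (simp add: nn assms norm_mult ennreal_mult nsq_nonneg)
  then have "(\<integral>\<^sup>+z. ennreal (cmod (f z * g z)) \<partial>circle)\<^sup>2 < \<infinity>"
    by (rule le_less_trans) simp
  then have fin: "(\<integral>\<^sup>+z. ennreal (cmod (f z * g z)) \<partial>circle) < \<infinity>"
    by (simp add: power_less_top_ennreal)
  show int: "integrable circle (\<lambda>z. f z * g z)"
    by (rule integrableI_bounded) (use fin in auto)
  have "ennreal ((LINT z|circle. cmod (f z * g z))\<^sup>2) \<le> ennreal (nsq f * nsq g)"
    using cs nn_integral_eq_integral[OF integrable_norm[OF int]]
    by (simp add: ennreal_power)
  then have "(LINT z|circle. cmod (f z * g z))\<^sup>2 \<le> nsq f * nsq g"
    by (simp add: ennreal_le_iff nsq_nonneg)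
  moreover have "(cmod (LINT z|circle. f z * g z))\<^sup>2 \<le> (LINT z|circle. cmod (f z * g z))\<^sup>2"
    by (intro power_mono integral_norm_bound) (simp del: integral_norm_bound)
  ultimately show "(cmod (LINT z|circle. f z * g z))\<^sup>2 \<le> nsq f * nsq g"
    by (rule order_trans[rotated])
qed

lemma L2_integrable: "f \<in> L2 \<Longrightarrow> integrable circle f"
  using integrable_L2_mult[OF _ const_L2, of f 1] by simp

section \<open>Algebra of the inner product\<close>

lemma L2_inner_le: "f \<in> L2 \<Longrightarrow> g \<in> L2 \<Longrightarrow> (cmod (L2_inner f g))\<^sup>2 \<le> nsq f * nsq g"
  using integral_L2_mult_le[OF _ L2_cnj, of f g] by (simp add: L2_inner_def nsq_def)

lemma L2_inner_integrable: "f \<in> L2 \<Longrightarrow> g \<in> L2 \<Longrightarrow> integrable circle (\<lambda>z. f z * cnj (g z))"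
  by (intro integrable_L2_mult L2_cnj)

lemma L2_inner_add_left:
  "f \<in> L2 \<Longrightarrow> g \<in> L2 \<Longrightarrow> h \<in> L2 \<Longrightarrow> L2_inner (\<lambda>z. f z + g z) h = L2_inner f h + L2_inner g h"
  by (simp add: L2_inner_def distrib_right L2_inner_integrable)

lemma L2_inner_diff_left:
  "f \<in> L2 \<Longrightarrow> g \<in> L2 \<Longrightarrow> h \<in> L2 \<Longrightarrow> L2_inner (\<lambda>z. f z - g z) h = L2_inner f h - L2_inner g h"
  by (simp add: L2_inner_def left_diff_distrib L2_inner_integrable)

lemma L2_inner_scale_left: "L2_inner (\<lambda>z. c * f z) h = c * L2_inner f h"
  by (simp add: L2_inner_def mult.assoc)

lemma L2_inner_sum_left:
  "(\<And>i. i \<in> I \<Longrightarrow> f i \<in> L2) \<Longrightarrow> h \<in> L2 \<Longrightarrow> L2_inner (\<lambda>z. \<Sum>i\<in>I. f i z) h = (\<Sum>i\<in>I. L2_inner (f i) h)"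
  by (simp add: L2_inner_def sum_distrib_right L2_inner_integrable)

lemma L2_inner_cnj: "cnj (L2_inner f g) = L2_inner g f"
  unfolding L2_inner_def by (subst Bochner_Integration.integral_cnj[symmetric]) (simp add: mult.commute)

lemma L2_inner_self: "L2_inner f f = complex_of_real (nsq f)"
  unfolding L2_inner_def nsq_def
  by (subst integral_complex_of_real[symmetric]) (simp add: complex_norm_square[symmetric])

section \<open>Rules for Fourier coefficients\<close>

lemma fourier_coeff_inner: "fourier_coeff f k = L2_inner f (\<lambda>z. z powi k)"
  by (simp add: fourier_coeff_def L2_inner_def)

lemma powi_L2: "(\<lambda>z. z powi k) \<in> L2"
  by (intro Linf_L2 Linf_powi)

lemma fourier_coeff_cong_AE:
  assumes "f \<in> borel_measurable circle" "g \<in> borel_measurable circle" "AE z in circle. f z = g z"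
  shows "fourier_coeff f k = fourier_coeff g k"
  unfolding fourier_coeff_def
proof (rule integral_cong_AE)
  note [measurable] = assms(1,2)
  have [measurable]: "(\<lambda>z. cnj (z powi k)) \<in> borel_measurable circle"
    by (intro L2_measurable L2_cnj powi_L2)
  show "(\<lambda>z. f z * cnj (z powi k)) \<in> borel_measurable circle"
    "(\<lambda>z. g z * cnj (z powi k)) \<in> borel_measurable circle" by measurable
qed (use assms(3) in auto)

lemma fourier_coeff_add: "f \<in> L2 \<Longrightarrow> g \<in> L2
  \<Longrightarrow> fourier_coeff (\<lambda>z. f z + g z) k = fourier_coeff f k + fourier_coeff g k"
  by (simp add: fourier_coeff_inner L2_inner_add_left powi_L2)

lemma fourier_coeff_diff: "f \<in> L2 \<Longrightarrow> g \<in> L2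
  \<Longrightarrow> fourier_coeff (\<lambda>z. f z - g z) k = fourier_coeff f k - fourier_coeff g k"
  by (simp add: fourier_coeff_inner L2_inner_diff_left powi_L2)

lemma fourier_coeff_scale: "fourier_coeff (\<lambda>z. c * f z) k = c * fourier_coeff f k"
  by (simp add: fourier_coeff_inner L2_inner_scale_left)

lemma fourier_coeff_sum:
  "(\<And>i. i \<in> I \<Longrightarrow> f i \<in> L2) \<Longrightarrow> fourier_coeff (\<lambda>z. \<Sum>i\<in>I. f i z) k = (\<Sum>i\<in>I. fourier_coeff (f i) k)"
  by (simp add: fourier_coeff_inner L2_inner_sum_left powi_L2)

lemma cnj_powi_circle:
  assumes "cmod z = 1"
  shows "cnj z powi k = z powi (-k)"
proof -
  have "inverse z = cnj z"
    using complex_norm_square[of z] assms by (intro inverse_unique) simp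
  then show ?thesis by (simp add: power_int_inverse power_int_minus flip: \<open>inverse z = cnj z\<close>)
qed

lemma fourier_coeff_shift: "fourier_coeff (\<lambda>z. z powi j * f z) k = fourier_coeff f (k - j)"
  unfolding fourier_coeff_def
proof (rule Bochner_Integration.integral_cong[OF refl])
  fix z assume z: "z \<in> space circle"
  then have "z \<noteq> 0" by auto
  then show "z powi j * f z * cnj (z powi k) = f z * cnj (z powi (k - j))"
    using z by (simp add: cnj_powi_circle power_int_diff power_int_minus field_simps)
qed

lemma fourier_coeff_reflect:
  assumes "f \<in> borel_measurable circle"
  shows "fourier_coeff (\<lambda>z. f (cnj z)) k = fourier_coeff f (-k)"
proof -
  note [measurable] = assms
  have [measurable]: "(\<lambda>z. cnj (z powi (-k))) \<in> borel_measurable circle"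
    by (intro L2_measurable L2_cnj powi_L2)
  have "(LINT z|circle. f (cnj z) * cnj (cnj z powi (-k))) = (LINT z|circle. f z * cnj (z powi (-k)))"
    by (rule integral_circle_cnj) measurable
  also have "(LINT z|circle. f (cnj z) * cnj (cnj z powi (-k)))
    = (LINT z|circle. f (cnj z) * cnj (z powi k))"
  proof (rule Bochner_Integration.integral_cong[OF refl])
    fix z assume "z \<in> space circle"
    then show "f (cnj z) * cnj (cnj z powi (-k)) = f (cnj z) * cnj (z powi k)"
      by (simp add: cnj_powi_circle)
  qed
  finally show ?thesis by (simp add: fourier_coeff_def)
qed

lemma fourier_coeff_cnj: "fourier_coeff (\<lambda>z. cnj (f z)) k = cnj (fourier_coeff f (-k))"
  unfolding fourier_coeff_def
  by (subst Bochner_Integration.integral_cnj[symmetric],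
      rule Bochner_Integration.integral_cong[OF refl]) (simp add: cnj_powi_circle)

lemma fourier_coeff_powi: "fourier_coeff (\<lambda>z. z powi j) k = (if j = k then 1 else 0)"
proof -
  have "fourier_coeff (\<lambda>z. 1) k = (if k = 0 then 1 else 0)" for k
  proof -
    have "fourier_coeff (\<lambda>z. 1) k = (LINT z|circle. z powi (-k))"
      unfolding fourier_coeff_def
      by (rule Bochner_Integration.integral_cong[OF refl]) (simp add: cnj_powi_circle)
    then show ?thesis by (simp add: integral_circle_powi)
  qed
  from this[of "k - j"] show ?thesis
    using fourier_coeff_shift[of j "\<lambda>z. 1" k] by simp
qed

section \<open>Uniqueness of Fourier coefficients\<close>

text \<open>The hypothetical counterexamples to uniqueness. They form a module over the
  trigonometric polynomials; the section then enlarges the class of multipliers that integrate to 0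
  against \<open>f\<close> to continuous functions, indicators of closed sets and indicators of
  Borel sets.\<close>

definition fourier_null :: "(complex \<Rightarrow> complex) \<Rightarrow> bool" where
  "fourier_null f \<longleftrightarrow> integrable circle f \<and> (\<forall>k. fourier_coeff f k = 0)"

lemma integrable_bounded_mult:
  fixes f :: "complex \<Rightarrow> complex"
  assumes "integrable circle f" "a \<in> Linf"
  shows "integrable circle (\<lambda>z. a z * f z)"
proof -
  obtain C where C: "AE z in circle. cmod (a z) \<le> C" and [measurable]: "a \<in> borel_measurable circle"
    using assms by (auto simp: Linf_def)
  note [measurable] = borel_measurable_integrable[OF assms(1)]
  show ?thesis
  proof (rule Bochner_Integration.integrable_bound)
    show "integrable circle (\<lambda>z. C *\<^sub>R f z)" using assms(1) by simp
    show "AE z in circle. cmod (a z * f z) \<le> cmod (C *\<^sub>R f z)"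
      using C by eventually_elim (auto simp: norm_mult intro!: mult_right_mono)
  qed measurable
qed

lemma fourier_coeff_add_integrable:
  assumes "integrable circle f" "integrable circle g"
  shows "fourier_coeff (\<lambda>z. f z + g z) k = fourier_coeff f k + fourier_coeff g k"
  using integrable_bounded_mult[OF assms(1) Linf_cnj[OF Linf_powi[of k]]]
    integrable_bounded_mult[OF assms(2) Linf_cnj[OF Linf_powi[of k]]]
  by (simp add: fourier_coeff_def distrib_right mult.commute[of "cnj _ powi _"])

lemma fourier_null_add: "fourier_null f \<Longrightarrow> fourier_null g \<Longrightarrow> fourier_null (\<lambda>z. f z + g z)"
  by (simp add: fourier_null_def fourier_coeff_add_integrable)

lemma fourier_null_scale: "fourier_null f \<Longrightarrow> fourier_null (\<lambda>z. c * f z)"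
  by (simp add: fourier_null_def fourier_coeff_scale)

lemma fourier_null_shift: "fourier_null f \<Longrightarrow> fourier_null (\<lambda>z. z powi j * f z)"
  by (simp add: fourier_null_def fourier_coeff_shift integrable_bounded_mult Linf_powi)

lemma fourier_null_cong:
  assumes "fourier_null f" "\<And>z. cmod z = 1 \<Longrightarrow> f z = g z"
  shows "fourier_null g"
proof -
  have "integrable circle f \<longleftrightarrow> integrable circle g"
    by (rule Bochner_Integration.integrable_cong) (auto simp: assms(2))
  moreover have "fourier_coeff f k = fourier_coeff g k" for k
    unfolding fourier_coeff_def
    by (rule Bochner_Integration.integral_cong) (auto simp: assms(2))
  ultimately show ?thesis using assms(1) by (simp add: fourier_null_def)
qed

text \<open>On the circle a real linear function is \<open>\<alpha> z + \<beta> z\<^sup>-\<^sup>1\<close>, so multiplication by it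
  only shifts and combines Fourier coefficients.\<close>

lemma fourier_null_polynomial_mult:
  assumes "real_polynomial_function p" "fourier_null f"
  shows "fourier_null (\<lambda>z. complex_of_real (p z) * f z)"
  using assms
proof (induction arbitrary: f rule: real_polynomial_function.induct)
  case (linear p)
  \<comment> \<open>On the circle Re z = (z + 1/z) / 2 and Im z = (z - 1/z) / (2 i); substituting
    these into \<open>Re z * p 1 + Im z * p \<i>\<close> gives the two coefficients.\<close>
  define \<alpha> \<beta> where "\<alpha> = (p 1 - \<i> * p \<i>) / 2" and "\<beta> = (p 1 + \<i> * p \<i>) / 2"
  have "fourier_null (\<lambda>z. \<alpha> * (z powi 1 * f z) + \<beta> * (z powi (-1) * f z))"
    by (intro fourier_null_add fourier_null_scale fourier_null_shift linear)
  then show ?case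
  proof (rule fourier_null_cong)
    fix z :: complex assume "cmod z = 1"
    then have "z powi (-1) = cnj z" using cnj_powi_circle[of z 1] by simp
    moreover have "p z = Re z * p 1 + Im z * p \<i>"
    proof -
      have "p (Re z *\<^sub>R 1 + Im z *\<^sub>R \<i>) = Re z * p 1 + Im z * p \<i>"
        using linear by (simp add: linear_simps bounded_linear.linear)
      moreover have "Re z *\<^sub>R 1 + Im z *\<^sub>R \<i> = z" by (simp add: complex_eq_iff)
      ultimately show ?thesis by simp
    qed
    moreover have "\<alpha> * z + \<beta> * cnj z = complex_of_real (Re z * p 1 + Im z * p \<i>)"
      by (simp add: \<alpha>_def \<beta>_def complex_eq_iff field_simps)
    ultimately have "\<alpha> * z powi 1 + \<beta> * z powi (-1) = complex_of_real (p z)"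
      by simp
    then show "\<alpha> * (z powi 1 * f z) + \<beta> * (z powi (-1) * f z) = complex_of_real (p z) * f z"
      by (simp only: mult.assoc[symmetric] distrib_right[symmetric])
  qed
next
  case (const c)
  then show ?case by (rule fourier_null_scale)
next
  case (add p q)
  then show ?case using fourier_null_add[OF add.IH(1) add.IH(2), of f f] by (simp add: distrib_right)
next
  case (mult p q)
  then show ?case using mult.IH(1)[OF mult.IH(2), of f] by (simp add: mult.assoc)
qed

lemma fourier_null_integral: "fourier_null f \<Longrightarrow> (LINT z|circle. f z) = 0"
  using spec[of "\<lambda>k. fourier_coeff f k = 0" 0] by (simp add: fourier_null_def fourier_coeff_def)

lemma Linf_continuous:
  assumes "continuous_on (sphere 0 1) a"
  shows "a \<in> Linf"
proof -
  have "bounded (a ` sphere 0 1)"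
    by (intro compact_imp_bounded compact_continuous_image assms) auto
  then obtain C where "\<forall>w \<in> a ` sphere 0 1. cmod w \<le> C"
    unfolding bounded_iff by blast
  then have "AE z in circle. cmod (a z) \<le> C" by (intro AE_I2) auto
  then show ?thesis using borel_measurable_circle_continuous[OF assms] by (auto simp: Linf_def)
qed

text \<open>By Stone-Weierstrass a real polynomial is uniformly close to \<open>g\<close> on the
  circle. Its product with \<open>f\<close> has integral 0, so the integral is at most the uniform
  error times the L1 norm of \<open>f\<close>.\<close>

lemma fourier_null_continuous:
  assumes "fourier_null f" "continuous_on (sphere 0 1) g"
  shows "(LINT z|circle. complex_of_real (g z) * f z) = 0"
proof -
  have f: "integrable circle f" using assms by (simp add: fourier_null_def)
  have g: "integrable circle (\<lambda>z. complex_of_real (g z) * f z)"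
    by (intro integrable_bounded_mult f Linf_continuous continuous_intros assms)
  have "cmod (LINT z|circle. complex_of_real (g z) * f z) \<le> 0 + e" if "e > 0" for e
  proof -
    \<comment> \<open>Adding 1 to the L1 norm keeps \<open>N\<close> positive also for vanishing
      \<open>f\<close>.\<close>
    define N where "N = (LINT z|circle. cmod (f z)) + 1"
    have N: "N > 0" by (simp add: N_def add_nonneg_pos)
    obtain p where p: "real_polynomial_function p" "\<And>z. z \<in> sphere 0 1 \<Longrightarrow> \<bar>g z - p z\<bar> < e / N"
      using Stone_Weierstrass_real_polynomial_function[of "sphere 0 1" g "e / N"] assms N \<open>e > 0\<close>
      by auto
    have pf: "fourier_null (\<lambda>z. complex_of_real (p z) * f z)"
      by (rule fourier_null_polynomial_mult[OF p(1) assms(1)])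
    then have pi: "integrable circle (\<lambda>z. complex_of_real (p z) * f z)"
      by (simp add: fourier_null_def)
    have "(LINT z|circle. complex_of_real (g z) * f z)
      = (LINT z|circle. complex_of_real (g z) * f z - complex_of_real (p z) * f z)"
      using g pi fourier_null_integral[OF pf] by simp
    also have "cmod \<dots>
      \<le> (LINT z|circle. cmod (complex_of_real (g z) * f z - complex_of_real (p z) * f z))"
      by (rule integral_norm_bound)
    also have "\<dots> \<le> (LINT z|circle. e / N * cmod (f z))"
    proof (rule integral_mono)
      fix z assume "z \<in> space circle"
      then have "\<bar>g z - p z\<bar> \<le> e / N" using p(2)[of z] by simp
      moreover have "cmod (complex_of_real (g z) * f z - complex_of_real (p z) * f z)
        = \<bar>g z - p z\<bar> * cmod (f z)"
        by (simp add: norm_mult flip: left_diff_distrib of_real_diff)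
      ultimately show "cmod (complex_of_real (g z) * f z - complex_of_real (p z) * f z)
        \<le> e / N * cmod (f z)"
        by (simp only: mult_right_mono norm_ge_zero)
    qed (use f g pi in auto)
    also have "\<dots> = e / N * (N - 1)" by (simp add: N_def)
    also have "\<dots> \<le> e" using N \<open>e > 0\<close> by (simp add: field_simps)
    finally show ?thesis by simp
  qed
  then have "cmod (LINT z|circle. complex_of_real (g z) * f z) \<le> 0" by (rule field_le_epsilon)
  then show ?thesis by simp
qed

text \<open>The approximating functions are continuous in \<open>z\<close>. They are 1 on
  \<open>C\<close>, and off \<open>C\<close> the distance is positive, so the sequence is eventually
  0 there.\<close>

lemma indicator_closed_limit:
  fixes C :: "complex set"
  assumes "closed C" "C \<noteq> {}"
  shows "(\<lambda>n. max 0 (1 - real n * infdist z C)) \<longlonglongrightarrow> indicator C z"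
proof (cases "z \<in> C")
  case False
  then have d: "infdist z C > 0"
    using assms by (metis in_closed_iff_infdist_zero infdist_nonneg order_le_less)
  obtain N where N: "1 < real N * infdist z C"
    using reals_Archimedean3[OF d] by blast
  have "\<forall>\<^sub>F n in sequentially. max 0 (1 - real n * infdist z C) = indicator C z"
  proof (rule eventually_sequentiallyI[of N])
    fix n assume "n \<ge> N"
    then have "real N * infdist z C \<le> real n * infdist z C" using d by (intro mult_right_mono) auto
    then show "max 0 (1 - real n * infdist z C) = indicator C z" using N False by simp
  qed
  then show ?thesis by (rule tendsto_eventually)
qed simp

lemma fourier_null_closed:
  assumes "fourier_null f" "closed C"
  shows "(LINT z|circle. indicator C z * f z) = 0"
\<comment> \<open>\<open>infdist z {}\<close> is 0 by convention, so for empty \<open>C\<close> the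
  approximating functions would tend to 1 instead of 0.\<close>
proof (cases "C = {}")
  case False
  define g where "g n z = max 0 (1 - real n * infdist z C)" for n z
  have f: "integrable circle f" using assms by (simp add: fourier_null_def)
  note [measurable] = borel_measurable_integrable[OF f]
  have cont: "continuous_on (sphere 0 1) (g n)" for n
    unfolding g_def by (intro continuous_intros)
  have [measurable]: "(\<lambda>z. complex_of_real (g n z)) \<in> borel_measurable circle" for n
    by (intro borel_measurable_circle_continuous continuous_intros cont)
  have lim: "(\<lambda>n. complex_of_real (g n z)) \<longlonglongrightarrow> indicator C z" for z
    using tendsto_of_real[OF indicator_closed_limit[OF assms(2) False, of z], where 'a = complex]
    by (simp only: g_def of_real_indicator)
  have "(\<lambda>n. LINT z|circle. complex_of_real (g n z) * f z) \<longlonglongrightarrow> (LINT z|circle. indicator C z * f z)"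
  proof (rule integral_dominated_convergence[where w = "\<lambda>z. cmod (f z)"])
    show "AE z in circle. cmod (complex_of_real (g n z) * f z) \<le> cmod (f z)" for n
    proof (rule AE_I2)
      fix z
      have "\<bar>g n z\<bar> \<le> 1" by (auto simp: g_def infdist_nonneg)
      then show "cmod (complex_of_real (g n z) * f z) \<le> cmod (f z)"
        by (simp add: norm_mult mult_left_le_one_le)
    qed
    show "AE z in circle. (\<lambda>n. complex_of_real (g n z) * f z) \<longlonglongrightarrow> indicator C z * f z"
      by (intro AE_I2 tendsto_mult lim tendsto_const)
    show "(\<lambda>z. indicator C z * f z) \<in> borel_measurable circle"
      by (rule borel_measurable_LIMSEQ_metric[where f="\<lambda>n z. complex_of_real (g n z) * f z"])
         (auto intro!: tendsto_mult lim)
  qed (use f in auto)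
  moreover have "(LINT z|circle. complex_of_real (g n z) * f z) = 0" for n
    by (rule fourier_null_continuous[OF assms(1) cont])
  ultimately show ?thesis by (simp add: LIMSEQ_const_iff)
qed simp

text \<open>Closed sets are stable under intersection and generate the Borel sets, so by Dynkin
  induction \<open>f\<close> integrates to 0 over every measurable subset of the circle. An
  integrable function with this property vanishes almost everywhere.\<close>

lemma fourier_null_AE:
  assumes "fourier_null f"
  shows "AE z in circle. f z = 0"
proof (rule circle.density_zero)
  show f: "integrable circle f" using assms by (simp add: fourier_null_def)
  note [measurable] = borel_measurable_integrable[OF f]
  have Int_stable_closed: "Int_stable (Collect (closed :: complex set \<Rightarrow> bool))"
    by (auto simp: Int_stable_def)
  have subset_Pow_UNIV: "Collect closed \<subseteq> Pow (UNIV :: complex set)"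
    by simp
  \<comment> \<open>The measurable sets of \<open>circle\<close> are traces of Borel sets on the
    sphere; writing the trace explicitly lets the induction run over Borel sets of the
    plane.\<close>
  have m: "A \<inter> sphere 0 1 \<in> sets circle" if "A \<in> sets borel" for A
    using that by (auto simp: sets_circle sets_restrict_space)
  have int: "integrable circle (\<lambda>z. indicator (A \<inter> sphere 0 1) z *\<^sub>R f z)" if "A \<in> sets borel" for A
    by (intro integrable_mult_indicator m that f)
  have "(LINT z|circle. indicator (A \<inter> sphere 0 1) z *\<^sub>R f z) = 0"
    if "A \<in> sigma_sets UNIV (Collect closed)" for A
    using Int_stable_closed subset_Pow_UNIV that
  proof (induction rule: sigma_sets_induct_disjoint)
    case (basic A)
    have "(LINT z|circle. indicator (A \<inter> sphere 0 1) z *\<^sub>R f z) = (LINT z|circle. indicator A z * f z)"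
      by (rule Bochner_Integration.integral_cong) (auto simp: indicator_def)
    then show ?case using fourier_null_closed[OF assms] basic by simp
  next
    case (compl A)
    then have A: "A \<in> sets borel" by (simp add: borel_eq_closed)
    have "(LINT z|circle. indicator ((UNIV - A) \<inter> sphere 0 1) z *\<^sub>R f z) =
        (LINT z|circle. f z - indicator (A \<inter> sphere 0 1) z *\<^sub>R f z)"
      by (rule Bochner_Integration.integral_cong) (auto simp: indicator_def)
    also have "\<dots> = 0" using int[OF A] f compl fourier_null_integral[OF assms] by simp
    finally show ?case .
  next
    case (union A)
    then have A: "A i \<in> sets borel" for i by (auto simp: borel_eq_closed)
    have "(LINT z|circle. indicator (\<Union>(range A) \<inter> sphere 0 1) z *\<^sub>R f z) =
      (LINT z:(\<Union>i. A i \<inter> sphere 0 1)|circle. f z)"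
      by (simp add: set_lebesgue_integral_def)
    also have "\<dots> = (\<Sum>i. (LINT z:(A i \<inter> sphere 0 1)|circle. f z))"
    proof (rule lebesgue_integral_countable_add)
      show "(A i \<inter> sphere 0 1) \<inter> (A j \<inter> sphere 0 1) = {}" if "i \<noteq> j" for i j
        using union(1) that by (auto simp: disjoint_family_on_def)
      have "integrable circle (\<lambda>z. indicator (\<Union>(range A) \<inter> sphere 0 1) z *\<^sub>R f z)"
        by (rule int) (use A in auto)
      then show "set_integrable circle (\<Union>i. A i \<inter> sphere 0 1) f"
        by (simp add: set_integrable_def)
    qed (use A m in auto)
    also have "\<dots> = 0" using union by (simp add: set_lebesgue_integral_def)
    finally show ?case .
  qed simp
  then have *: "(LINT z|circle. indicator (A \<inter> sphere 0 1) z *\<^sub>R f z) = 0" if "A \<in> sets borel" for A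
    using that by (simp add: borel_eq_closed)
  fix A assume "A \<in> sets circle"
  then obtain B where "B \<in> sets borel" "A = B \<inter> sphere 0 1"
    by (auto simp: sets_circle sets_restrict_space)
  then show "set_lebesgue_integral circle A f = 0"
    using * by (simp add: set_lebesgue_integral_def)
qed

lemma L2_eq_AE:
  assumes "f \<in> L2" "g \<in> L2" "\<And>k. fourier_coeff f k = fourier_coeff g k"
  shows "AE z in circle. f z = g z"
proof -
  have "fourier_null (\<lambda>z. f z - g z)"
    using assms by (simp add: fourier_null_def fourier_coeff_diff L2_integrable)
  from fourier_null_AE[OF this] show ?thesis by simp
qed

section \<open>Completeness and the projection onto the Hardy space\<close>

text \<open>Riesz-Fischer: a rapidly converging subsequence has an almost everywhere limit, and
  Fatou's lemma shows that the whole sequence converges to it in norm.\<close>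

lemma L2_complete:
  fixes u :: "nat \<Rightarrow> complex \<Rightarrow> complex"
  assumes u: "\<And>n. u n \<in> L2"
    and cauchy: "\<And>e. e > 0 \<Longrightarrow> \<exists>N. \<forall>m\<ge>N. \<forall>n\<ge>N. nsq (\<lambda>z. u m z - u n z) \<le> e"
  obtains g where "g \<in> L2" "(\<lambda>n. nsq (\<lambda>z. u n z - g z)) \<longlonglongrightarrow> 0"
proof -
  note [measurable] = L2_measurable[OF u]
  \<comment> \<open>\<open>nsq\<close> is the square of the norm, so the bound
    \<open>(1/4)^k\<close> means a norm of at most \<open>(1/2)^k\<close>, which is
    summable.\<close>
  have "\<exists>N. \<forall>m\<ge>N. \<forall>n\<ge>N. nsq (\<lambda>z. u m z - u n z) \<le> (1/4)^k" for k :: nat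
    by (rule cauchy) simp
  then obtain N where N: "\<And>k m n. m \<ge> N k \<Longrightarrow> n \<ge> N k \<Longrightarrow> nsq (\<lambda>z. u m z - u n z) \<le> (1/4)^k"
    by metis
  \<comment> \<open>Summing all thresholds makes both \<open>r k\<close> and
    \<open>r (Suc k)\<close> at least \<open>N k\<close>; the extra summand \<open>k\<close> makes
    \<open>r\<close> unbounded.\<close>
  define r where "r k = (\<Sum>i\<le>k. N i) + k" for k
  have r_ge: "r k \<ge> N k" "r k \<ge> k" for k
    by (auto simp: r_def intro: trans_le_add1 member_le_sum)
  have r_Suc: "r (Suc k) \<ge> N k" for k
    using r_ge(1)[of k] by (simp add: r_def)
  define d where "d k z = u (r (Suc k)) z - u (r k) z" for k z
  have d: "d k \<in> L2" for k unfolding d_def by (intro L2_diff u)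
  note [measurable] = L2_measurable[OF d]
  have d_int: "(\<integral>\<^sup>+z. ennreal (cmod (d k z)) \<partial>circle) \<le> ennreal ((1/2)^k)" for k
  proof -
    \<comment> \<open>This majorant of the modulus of \<open>d k\<close> comes from the inequality
      of arithmetic and geometric means with weight \<open>2^k\<close>; the constant term is
      integrated over a probability space.\<close>
    have int: "integrable circle (\<lambda>z. (2^k * (cmod (d k z))\<^sup>2 + (1/2)^k) / 2)"
      using L2_integrable_sq[OF d[of k]] by (auto intro: circle.integrable_const)
    have "(LINT z|circle. cmod (d k z)) \<le> (LINT z|circle. (2^k * (cmod (d k z))\<^sup>2 + (1/2)^k) / 2)"
    proof (rule integral_mono[OF _ int])
      fix z
      have "0 \<le> 2^k * (cmod (d k z) - (1/2)^k)\<^sup>2" by simp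
      also have "\<dots> = 2^k * (cmod (d k z))\<^sup>2 + (1/2)^k - 2 * cmod (d k z)"
        by (simp add: power2_eq_square algebra_simps power_one_over)
      finally show "cmod (d k z) \<le> (2^k * (cmod (d k z))\<^sup>2 + (1/2)^k) / 2" by simp
    qed (intro integrable_norm L2_integrable d)
    also have "\<dots> = (2^k * nsq (d k) + (1/2)^k) / 2"
      using L2_integrable_sq[OF d[of k]] circle.prob_space by (simp add: nsq_def)
    also have "\<dots> \<le> (2^k * (1/4)^k + (1/2)^k) / 2"
      using N[OF r_Suc r_ge(1), of k] by (simp add: d_def[abs_def])
    also have "(2::real)^k * (1/4)^k = (1/2)^k"
      by (simp flip: power_mult_distrib)
    finally have "(LINT z|circle. cmod (d k z)) \<le> (1/2)^k" by simp
    then show ?thesis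
      by (subst nn_integral_eq_integral) (auto intro!: ennreal_leI integrable_norm L2_integrable d)
  qed
  have "(\<integral>\<^sup>+z. (\<Sum>k. ennreal (cmod (d k z))) \<partial>circle) = (\<Sum>k. \<integral>\<^sup>+z. ennreal (cmod (d k z)) \<partial>circle)"
    by (rule nn_integral_suminf) measurable
  also have "\<dots> \<le> (\<Sum>k. ennreal ((1/2)^k))"
    by (intro suminf_le d_int) auto
  also have "\<dots> = ennreal (\<Sum>k. (1/2)^k)"
    by (intro suminf_ennreal2) (auto intro: summable_geometric)
  also have "\<dots> < \<infinity>" by simp
  finally have "AE z in circle. (\<Sum>k. ennreal (cmod (d k z))) \<noteq> \<infinity>"
    by (intro nn_integral_noteq_infinite) auto
  then have conv: "AE z in circle. convergent (\<lambda>k. u (r k) z)"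
  proof eventually_elim
    case (elim z)
    then have "summable (\<lambda>k. cmod (d k z))"
      by (intro summable_suminf_not_top) auto
    then have "summable (\<lambda>k. d k z)" by (rule summable_norm_cancel)
    then have "convergent (\<lambda>n. \<Sum>k<n. d k z)" by (simp add: summable_iff_convergent)
    then have "convergent (\<lambda>n. u (r n) z - u (r 0) z)"
      using sum_lessThan_telescope[of "\<lambda>k. u (r k) z"] by (simp add: d_def)
    from convergent_add[OF this convergent_const[of "u (r 0) z"]] show ?case by simp
  qed
  \<comment> \<open>Where the subsequence diverges, \<open>lim\<close> is unspecified; this concerns
    a null set only.\<close>
  define g where "g z = lim (\<lambda>k. u (r k) z)" for z
  have [measurable]: "g \<in> borel_measurable circle"
    unfolding g_def by (rule borel_measurable_lim_metric) measurable
  have g_lim: "AE z in circle. (\<lambda>k. u (r k) z) \<longlonglongrightarrow> g z"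
    using conv by eventually_elim (simp add: g_def convergent_LIMSEQ_iff)
  \<comment> \<open>Used twice: with bound 1 = (1/4)^0 beyond \<open>N 0\<close>, to place
    \<open>g\<close> in \<open>L2\<close>, and with \<open>e / 2\<close>, to obtain convergence in
    norm.\<close>
  have fatou: "(\<integral>\<^sup>+z. ennreal ((cmod (u n z - g z))\<^sup>2) \<partial>circle) \<le> ennreal e"
    if n: "\<And>m. m \<ge> M \<Longrightarrow> nsq (\<lambda>z. u n z - u m z) \<le> e" for n M e
  proof -
    have "(\<integral>\<^sup>+z. ennreal ((cmod (u n z - g z))\<^sup>2) \<partial>circle)
        = (\<integral>\<^sup>+z. liminf (\<lambda>k. ennreal ((cmod (u n z - u (r k) z))\<^sup>2)) \<partial>circle)"
    proof (rule nn_integral_cong_AE)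
      show "AE z in circle. ennreal ((cmod (u n z - g z))\<^sup>2)
        = liminf (\<lambda>k. ennreal ((cmod (u n z - u (r k) z))\<^sup>2))"
        using g_lim
      proof eventually_elim
        case (elim z)
        then have "(\<lambda>k. ennreal ((cmod (u n z - u (r k) z))\<^sup>2)) \<longlonglongrightarrow> ennreal ((cmod (u n z - g z))\<^sup>2)"
          by (intro tendsto_intros)
        then show ?case by (rule lim_imp_Liminf[symmetric, rotated]) simp
      qed
    qed
    also have "\<dots> \<le> liminf (\<lambda>k. \<integral>\<^sup>+z. ennreal ((cmod (u n z - u (r k) z))\<^sup>2) \<partial>circle)"
      by (rule nn_integral_liminf) measurable
    also have "\<dots> = liminf (\<lambda>k. ennreal (nsq (\<lambda>z. u n z - u (r k) z)))"
      by (simp add: nsq_def nn_integral_eq_integral L2_integrable_sq L2_diff u)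
    also have "\<dots> \<le> limsup (\<lambda>k. ennreal (nsq (\<lambda>z. u n z - u (r k) z)))"
      by (rule Liminf_le_Limsup) simp
    also have "\<dots> \<le> ennreal e"
    proof (rule Limsup_bounded)
      show "\<forall>\<^sub>F k in sequentially. ennreal (nsq (\<lambda>z. u n z - u (r k) z)) \<le> ennreal e"
        by (rule eventually_sequentiallyI[of M]) (intro ennreal_leI n, use r_ge(2) order_trans in blast)
    qed
    finally show ?thesis .
  qed
  have diff: "(\<lambda>z. u n z - g z) \<in> L2" if "n \<ge> N 0" for n
  proof -
    have "(\<integral>\<^sup>+z. ennreal ((cmod (u n z - g z))\<^sup>2) \<partial>circle) \<le> ennreal 1"
      by (rule fatou[of "N 0"]) (use N[of 0] that in simp)
    then have "(\<integral>\<^sup>+z. ennreal ((cmod (u n z - g z))\<^sup>2) \<partial>circle) < \<infinity>"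
      by (rule le_less_trans) simp
    then show ?thesis by (auto simp: L2_def intro!: integrableI_bounded)
  qed
  have g: "g \<in> L2" using L2_diff[OF u[of "N 0"] diff[of "N 0"]] by simp
  moreover have "(\<lambda>n. nsq (\<lambda>z. u n z - g z)) \<longlonglongrightarrow> 0"
  proof (rule LIMSEQ_I)
    fix e :: real assume "e > 0"
    then obtain M where M: "\<And>m n. m \<ge> M \<Longrightarrow> n \<ge> M \<Longrightarrow> nsq (\<lambda>z. u m z - u n z) \<le> e / 2"
      using cauchy[of "e/2"] by auto
    have "nsq (\<lambda>z. u n z - g z) < e" if "n \<ge> M" for n
    proof -
      have "ennreal (nsq (\<lambda>z. u n z - g z)) \<le> ennreal (e / 2)"
        using fatou[of M n "e/2"] M[OF that] L2_integrable_sq[OF L2_diff[OF u[of n] g]]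
        by (simp add: nsq_def nn_integral_eq_integral)
      then show ?thesis using \<open>e > 0\<close> by (simp add: ennreal_le_iff)
    qed
    then show "\<exists>no. \<forall>n\<ge>no. norm (nsq (\<lambda>z. u n z - g z) - 0) < e"
      by (auto simp: nsq_nonneg intro!: exI[of _ M])
  qed
  ultimately show thesis by (rule that)
qed

lemma L2_inner_tendsto:
  assumes "\<And>n. u n \<in> L2" "g \<in> L2" "h \<in> L2" "(\<lambda>n. nsq (\<lambda>z. u n z - g z)) \<longlonglongrightarrow> 0"
  shows "(\<lambda>n. L2_inner (u n) h) \<longlonglongrightarrow> L2_inner g h"
proof -
  have "(\<lambda>n. sqrt (nsq (\<lambda>z. u n z - g z) * nsq h)) \<longlonglongrightarrow> sqrt (0 * nsq h)"
    by (intro tendsto_intros assms)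
  then have lim: "(\<lambda>n. sqrt (nsq (\<lambda>z. u n z - g z) * nsq h)) \<longlonglongrightarrow> 0" by simp
  have "cmod (L2_inner (u n) h - L2_inner g h) \<le> sqrt (nsq (\<lambda>z. u n z - g z) * nsq h)" for n
    using L2_inner_le[OF L2_diff[OF assms(1,2)] assms(3), of n]
    by (intro real_le_rsqrt) (simp add: L2_inner_diff_left assms)
  then have "(\<lambda>n. L2_inner (u n) h - L2_inner g h) \<longlonglongrightarrow> 0"
    by (intro Lim_null_comparison[OF _ lim]) simp
  then show ?thesis by (simp add: LIM_zero_iff)
qed

section \<open>Trigonometric sums and Bessel's inequality\<close>

definition trig_sum :: "(int \<Rightarrow> complex) \<Rightarrow> int set \<Rightarrow> complex \<Rightarrow> complex" where
  "trig_sum a K z = (\<Sum>k\<in>K. a k * z powi k)"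

lemma trig_sum_L2: "trig_sum a K \<in> L2"
  unfolding trig_sum_def[abs_def] by (intro L2_sum L2_scale powi_L2)

lemma L2_inner_trig_sum: "h \<in> L2 \<Longrightarrow> L2_inner (trig_sum a K) h = (\<Sum>k\<in>K. a k * cnj (fourier_coeff h k))"
  unfolding trig_sum_def[abs_def]
  by (simp add: L2_inner_sum_left L2_scale powi_L2 L2_inner_scale_left fourier_coeff_inner L2_inner_cnj)

lemma fourier_coeff_trig_sum:
  "finite K \<Longrightarrow> fourier_coeff (trig_sum a K) m = (if m \<in> K then a m else 0)"
  unfolding trig_sum_def[abs_def]
  by (simp add: fourier_coeff_sum L2_scale powi_L2 fourier_coeff_scale fourier_coeff_powi if_distrib
    cong: if_cong)

lemma nsq_trig_sum: "finite K \<Longrightarrow> nsq (trig_sum a K) = (\<Sum>k\<in>K. (cmod (a k))\<^sup>2)"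
proof -
  assume "finite K"
  then have "complex_of_real (nsq (trig_sum a K)) = complex_of_real (\<Sum>k\<in>K. (cmod (a k))\<^sup>2)"
    by (subst L2_inner_self[symmetric])
       (simp add: L2_inner_trig_sum trig_sum_L2 fourier_coeff_trig_sum complex_norm_square del: of_real_power)
  then show ?thesis by (simp only: of_real_eq_iff)
qed

text \<open>With \<open>S\<close> the partial sum over \<open>K\<close> and \<open>b\<close> the
  left side, the inner products of \<open>S\<close> with \<open>f\<close>, of \<open>f\<close> with
  \<open>S\<close> and of \<open>S\<close> with itself all equal \<open>b\<close>. Hence the squared
  norm of the difference \<open>f - S\<close> is \<open>nsq f - b\<close>.\<close>

lemma Bessel:
  assumes f: "f \<in> L2" and "finite K"
  shows "(\<Sum>k\<in>K. (cmod (fourier_coeff f k))\<^sup>2) \<le> nsq f"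
proof -
  define S where "S = trig_sum (fourier_coeff f) K"
  define b where "b = (\<Sum>k\<in>K. (cmod (fourier_coeff f k))\<^sup>2)"
  have S: "S \<in> L2" by (simp add: S_def trig_sum_L2)
  have Sf: "L2_inner S f = complex_of_real b"
    unfolding S_def b_def by (simp add: L2_inner_trig_sum f complex_norm_square del: of_real_power)
  have SS: "L2_inner S S = complex_of_real b"
    unfolding L2_inner_self by (simp add: S_def b_def nsq_trig_sum assms)
  have fS: "L2_inner f S = complex_of_real b"
    using L2_inner_cnj[of S f] Sf by simp
  have "complex_of_real (nsq (\<lambda>z. f z - S z)) = L2_inner (\<lambda>z. f z - S z) (\<lambda>z. f z - S z)"
    by (simp add: L2_inner_self)
  also have "\<dots> = L2_inner f (\<lambda>z. f z - S z) - L2_inner S (\<lambda>z. f z - S z)"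
    by (intro L2_inner_diff_left f S L2_diff)
  also have "L2_inner f (\<lambda>z. f z - S z) = cnj (L2_inner (\<lambda>z. f z - S z) f)"
    by (simp add: L2_inner_cnj)
  also have "\<dots> = complex_of_real (nsq f - b)"
    by (simp add: L2_inner_diff_left f S L2_inner_self Sf)
  also have "L2_inner S (\<lambda>z. f z - S z) = cnj (L2_inner (\<lambda>z. f z - S z) S)"
    by (simp add: L2_inner_cnj)
  also have "\<dots> = 0"
    by (simp add: L2_inner_diff_left f S SS fS)
  finally have "nsq (\<lambda>z. f z - S z) = nsq f - b"
    by (simp only: diff_zero of_real_eq_iff)
  then show ?thesis using nsq_nonneg[of "\<lambda>z. f z - S z"] by (simp add: b_def)
qed

text \<open>The partial sums over nonnegative indices are Cauchy by Bessel's inequality, and inner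
  products pass to the limit. The last conclusion, evident for trigonometric sums, survives the
  limit and later gives the orthogonality of \<open>H2\<close> to functions without nonnegative
  frequencies.\<close>

lemma analytic_part_exists:
  assumes f: "f \<in> L2"
  obtains g where "g \<in> L2" "\<And>k. fourier_coeff g k = (if k \<ge> 0 then fourier_coeff f k else 0)"
    "\<And>h. h \<in> L2 \<Longrightarrow> (\<And>k. k \<ge> 0 \<Longrightarrow> fourier_coeff h k = 0) \<Longrightarrow> L2_inner g h = 0"
proof -
  define a where "a = fourier_coeff f"
  define u where "u n = trig_sum a {0..<int n}" for n
  have u: "u n \<in> L2" for n by (simp add: u_def trig_sum_L2)
  have sum_int: "(\<Sum>k\<in>{int m..<int n}. (cmod (a k))\<^sup>2) = (\<Sum>k\<in>{m..<n}. (cmod (a (int k)))\<^sup>2)" for m n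
    by (rule sum.reindex_bij_witness[of _ int nat]) auto
  have "(\<Sum>k<n. (cmod (a (int k)))\<^sup>2) \<le> nsq f" for n
    using Bessel[OF f, of "{int 0..<int n}"] sum_int[of 0 n]
    by (simp add: a_def atLeast0LessThan)
  then have summ: "summable (\<lambda>k. (cmod (a (int k)))\<^sup>2)"
    by (intro summableI_nonneg_bounded) auto
  have nsq_diff: "nsq (\<lambda>z. u n z - u m z) = (\<Sum>k\<in>{m..<n}. (cmod (a (int k)))\<^sup>2)" if "m \<le> n" for m n
  proof -
    have "u n z - u m z = trig_sum a {int m..<int n} z" for z
    proof -
      have "{0..<int n} = {0..<int m} \<union> {int m..<int n}" using that by auto
      then show ?thesis by (simp add: u_def trig_sum_def sum.union_disjoint)
    qed
    then show ?thesis by (simp add: nsq_trig_sum sum_int cong: if_cong)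
  qed
  have nsq_sym: "nsq (\<lambda>z. u n z - u m z) = nsq (\<lambda>z. u m z - u n z)" for m n
    by (simp add: nsq_def norm_minus_commute)
  have "\<exists>N. \<forall>m\<ge>N. \<forall>n\<ge>N. nsq (\<lambda>z. u m z - u n z) \<le> e" if "e > 0" for e
  proof -
    obtain N where N: "\<And>m n. m \<ge> N \<Longrightarrow> norm (\<Sum>k\<in>{m..<n}. (cmod (a (int k)))\<^sup>2) < e"
      using summ \<open>e > 0\<close> unfolding summable_Cauchy by blast
    have "nsq (\<lambda>z. u m z - u n z) \<le> e" if "m \<ge> N" "n \<ge> N" for m n
      using N[of m n] N[of n m] that nsq_diff[of m n] nsq_diff[of n m] nsq_sym[of m n]
      by (cases "m \<le> n") auto
    then show ?thesis by blast
  qed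
  from L2_complete[OF u this] obtain g where g: "g \<in> L2" "(\<lambda>n. nsq (\<lambda>z. u n z - g z)) \<longlonglongrightarrow> 0"
    by blast
  show thesis
  proof (rule that[OF g(1)])
    fix k
    have "(\<lambda>n. fourier_coeff (u n) k) \<longlonglongrightarrow> fourier_coeff g k"
      unfolding fourier_coeff_inner by (intro L2_inner_tendsto u g powi_L2)
    moreover have "(\<lambda>n. fourier_coeff (u n) k) \<longlonglongrightarrow> (if k \<ge> 0 then fourier_coeff f k else 0)"
      by (rule tendsto_eventually, rule eventually_sequentiallyI[of "Suc (nat k)"])
         (auto simp: u_def fourier_coeff_trig_sum a_def)
    ultimately show "fourier_coeff g k = (if k \<ge> 0 then fourier_coeff f k else 0)"
      by (rule LIMSEQ_unique)
  next
    fix h assume h: "h \<in> L2" "\<And>k. k \<ge> 0 \<Longrightarrow> fourier_coeff h k = 0"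
    have "(\<lambda>n. L2_inner (u n) h) \<longlonglongrightarrow> L2_inner g h"
      by (intro L2_inner_tendsto u g h)
    moreover have "L2_inner (u n) h = 0" for n
      by (simp add: u_def L2_inner_trig_sum h)
    ultimately show "L2_inner g h = 0" by (simp add: LIMSEQ_const_iff)
  qed
qed

section \<open>The Hardy space and its projection\<close>

lemma L2_inner_cong_AE:
  assumes "f \<in> L2" "f' \<in> L2" "h \<in> L2" "AE z in circle. f z = f' z"
  shows "L2_inner f h = L2_inner f' h"
  unfolding L2_inner_def
proof (rule integral_cong_AE)
  show "(\<lambda>z. f z * cnj (h z)) \<in> borel_measurable circle"
    "(\<lambda>z. f' z * cnj (h z)) \<in> borel_measurable circle"
    using L2_inner_integrable assms by auto
qed (use assms in auto)

lemma H2D: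
  assumes "f \<in> H2"
  shows H2_L2: "f \<in> L2" and H2_coeff: "\<And>k. k < 0 \<Longrightarrow> fourier_coeff f k = 0"
  using assms by (auto simp: H2_def)

text \<open>By uniqueness \<open>f\<close> agrees almost everywhere with its own analytic part, for
  which orthogonality is known.\<close>

lemma H2_orthogonal:
  assumes "f \<in> H2" "h \<in> L2" "\<And>k. k \<ge> 0 \<Longrightarrow> fourier_coeff h k = 0"
  shows "L2_inner f h = 0"
proof -
  note f = H2D[OF assms(1)]
  obtain g where g: "g \<in> L2" "\<And>k. fourier_coeff g k = (if k \<ge> 0 then fourier_coeff f k else 0)"
    "\<And>h. h \<in> L2 \<Longrightarrow> (\<And>k. k \<ge> 0 \<Longrightarrow> fourier_coeff h k = 0) \<Longrightarrow> L2_inner g h = 0"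
    using analytic_part_exists[OF f(1)] by metis
  have "AE z in circle. f z = g z"
    by (rule L2_eq_AE) (use f g in auto)
  then have "L2_inner f h = L2_inner g h"
    by (intro L2_inner_cong_AE f g assms)
  then show ?thesis using g assms by simp
qed

lemma powi_H2: "k \<ge> 0 \<Longrightarrow> (\<lambda>z. z powi k) \<in> H2"
  by (simp add: H2_def powi_L2 fourier_coeff_powi)

text \<open>The analytic part \<open>g\<close> is a witness for the choice: \<open>f - g\<close> has
  no nonnegative frequencies and is therefore orthogonal to \<open>H2\<close>. Whichever function is
  chosen, testing it against powers of z determines its coefficients.\<close>

lemma proj_H2:
  assumes f: "f \<in> L2"
  shows proj_H2_in: "proj_H2 f \<in> H2"
    and fourier_coeff_proj: "fourier_coeff (proj_H2 f) k = (if k \<ge> 0 then fourier_coeff f k else 0)"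
    and proj_H2_inner: "h \<in> H2 \<Longrightarrow> L2_inner (proj_H2 f) h = L2_inner f h"
proof -
  obtain g where g: "g \<in> L2" "\<And>k. fourier_coeff g k = (if k \<ge> 0 then fourier_coeff f k else 0)"
    using analytic_part_exists[OF f] by metis
  have "g \<in> H2 \<and> (\<forall>h\<in>H2. L2_inner (\<lambda>z. f z - g z) h = 0)"
  proof (intro conjI ballI)
    show "g \<in> H2" using g by (simp add: H2_def)
    fix h assume "h \<in> H2"
    then have "L2_inner h (\<lambda>z. f z - g z) = 0"
      by (rule H2_orthogonal) (use f g in \<open>simp_all add: L2_diff fourier_coeff_diff\<close>)
    then show "L2_inner (\<lambda>z. f z - g z) h = 0"
      using L2_inner_cnj[of h "\<lambda>z. f z - g z"] by simp
  qed
  then have *: "proj_H2 f \<in> H2 \<and> (\<forall>h\<in>H2. L2_inner (\<lambda>z. f z - proj_H2 f z) h = 0)"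
    unfolding proj_H2_def
      by (rule someI[where P = "\<lambda>g. g \<in> H2 \<and> (\<forall>h\<in>H2. L2_inner (\<lambda>z. f z - g z) h = 0)"])
  then show P: "proj_H2 f \<in> H2" by blast
  have inner: "L2_inner (proj_H2 f) h = L2_inner f h" if "h \<in> H2" for h
    using * that L2_inner_diff_left[OF f H2_L2[OF P] H2_L2[OF that]] by simp
  then show "h \<in> H2 \<Longrightarrow> L2_inner (proj_H2 f) h = L2_inner f h" .
  show "fourier_coeff (proj_H2 f) k = (if k \<ge> 0 then fourier_coeff f k else 0)"
    using inner[OF powi_H2[of k]] H2D[OF P] by (auto simp: fourier_coeff_inner)
qed

section \<open>Vector-valued functions\<close>

definition L2_vec :: "(complex \<Rightarrow> complex^'n) set" where
  "L2_vec = {f. \<forall>i. (\<lambda>z. f z $ i) \<in> L2}"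

definition vcoeff :: "(complex \<Rightarrow> complex^'n) \<Rightarrow> int \<Rightarrow> complex^'n" where
  "vcoeff f k = (\<chi> i. fourier_coeff (\<lambda>z. f z $ i) k)"

definition mcoeff :: "(complex \<Rightarrow> complex^'n^'m) \<Rightarrow> int \<Rightarrow> complex^'n^'m" where
  "mcoeff F k = (\<chi> i j. fourier_coeff (\<lambda>z. F z $ i $ j) k)"

text \<open>The flip \<open>J\<close> of the outline. It exchanges the indices \<open>k\<close> and
  \<open>- k - 1\<close>, hence nonnegative and negative frequencies.\<close>

definition reflect :: "(complex \<Rightarrow> complex^'n) \<Rightarrow> complex \<Rightarrow> complex^'n" where
  "reflect f z = cnj z *s f (cnj z)"

lemma L2_vec_entry: "f \<in> L2_vec \<Longrightarrow> (\<lambda>z. f z $ i) \<in> L2"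
  by (simp add: L2_vec_def)

lemma Linf_mat_entry: "F \<in> Linf_mat \<Longrightarrow> (\<lambda>z. F z $ i $ j) \<in> Linf"
  by (simp add: Linf_mat_def)

lemma L2_vec_add: "f \<in> L2_vec \<Longrightarrow> g \<in> L2_vec \<Longrightarrow> (\<lambda>z. f z + g z) \<in> L2_vec"
  by (simp add: L2_vec_def L2_add)

lemma L2_vec_const: "(\<lambda>z. c) \<in> L2_vec"
  by (simp add: L2_vec_def const_L2)

lemma L2_vec_shift: "f \<in> L2_vec \<Longrightarrow> (\<lambda>z. z powi j *s f z) \<in> L2_vec"
  by (simp add: L2_vec_def Linf_mult_L2 Linf_powi)

lemma L2_vec_reflect: "f \<in> L2_vec \<Longrightarrow> reflect f \<in> L2_vec"
  using L2_reflect[OF Linf_mult_L2[OF Linf_powi[of 1] L2_vec_entry[of f]]]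
  by (auto simp: L2_vec_def reflect_def[abs_def])

lemma L2_vec_mult: "F \<in> Linf_mat \<Longrightarrow> f \<in> L2_vec \<Longrightarrow> (\<lambda>z. F z *v f z) \<in> L2_vec"
  by (simp add: L2_vec_def Linf_mat_def matrix_vector_mult_def L2_sum Linf_mult_L2)

lemma Linf_mat_const: "(\<lambda>z. A) \<in> Linf_mat"
  by (simp add: Linf_mat_def Linf_const)

lemma L2_vec_const_mult: "f \<in> L2_vec \<Longrightarrow> (\<lambda>z. A *v f z) \<in> L2_vec"
  by (rule L2_vec_mult[OF Linf_mat_const])

lemma Linf_mat_add: "F \<in> Linf_mat \<Longrightarrow> G \<in> Linf_mat \<Longrightarrow> (\<lambda>z. F z + G z) \<in> Linf_mat"
  by (simp add: Linf_mat_def Linf_add)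

lemma Linf_mat_diff: "F \<in> Linf_mat \<Longrightarrow> G \<in> Linf_mat \<Longrightarrow> (\<lambda>z. F z - G z) \<in> Linf_mat"
  by (simp add: Linf_mat_def Linf_diff)

lemma Linf_mat_mult: "F \<in> Linf_mat \<Longrightarrow> G \<in> Linf_mat \<Longrightarrow> (\<lambda>z. F z ** G z) \<in> Linf_mat"
  by (simp add: Linf_mat_def matrix_matrix_mult_def Linf_sum Linf_mult)

lemma Linf_mat_conj_transpose: "F \<in> Linf_mat \<Longrightarrow> (\<lambda>z. conj_transpose (F z)) \<in> Linf_mat"
  by (simp add: Linf_mat_def conj_transpose_def Linf_cnj)

lemma Linf_mat_reflect: "F \<in> Linf_mat \<Longrightarrow> (\<lambda>z. F (cnj z)) \<in> Linf_mat"
  using Linf_reflect[OF Linf_mat_entry[of F]] by (auto simp: Linf_mat_def)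

section \<open>Fourier coefficients of vector and matrix functions\<close>

lemma vcoeff_add: "f \<in> L2_vec \<Longrightarrow> g \<in> L2_vec \<Longrightarrow> vcoeff (\<lambda>z. f z + g z) k = vcoeff f k + vcoeff g k"
  by (simp add: vcoeff_def vec_eq_iff fourier_coeff_add L2_vec_entry)

lemma vcoeff_const_mult: "f \<in> L2_vec \<Longrightarrow> vcoeff (\<lambda>z. A *v f z) k = A *v vcoeff f k"
  by (simp add: vcoeff_def vec_eq_iff matrix_vector_mult_def fourier_coeff_sum L2_scale
      fourier_coeff_scale L2_vec_entry)

lemma vcoeff_mult_const:
  assumes "\<And>i j. (\<lambda>z. F z $ i $ j) \<in> L2"
  shows "vcoeff (\<lambda>z. F z *v c) k = mcoeff F k *v c"
  using assms
  by (simp add: vcoeff_def mcoeff_def vec_eq_iff matrix_vector_mult_def fourier_coeff_sum L2_scale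
      fourier_coeff_scale mult.commute[of _ "c $ _"])

lemma vcoeff_shift: "vcoeff (\<lambda>z. z powi j *s f z) k = vcoeff f (k - j)"
  by (simp add: vcoeff_def vec_eq_iff fourier_coeff_shift)

lemma vcoeff_const: "vcoeff (\<lambda>z. c) k = (if k = 0 then c else 0)"
proof -
  have "fourier_coeff (\<lambda>z. c $ i) k = (if k = 0 then c $ i else 0)" for i
    using fourier_coeff_scale[of "c $ i" "\<lambda>z. 1" k] fourier_coeff_powi[of 0 k] by simp
  then show ?thesis by (simp add: vcoeff_def vec_eq_iff)
qed

text \<open>\<open>reflect f\<close> is the function z f(z) evaluated at \<open>cnj z\<close>:
  conjugation negates the index, and the factor z contributes the shift by one.\<close>

lemma vcoeff_reflect:
  assumes "f \<in> L2_vec"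
  shows "vcoeff (reflect f) k = vcoeff f (- k - 1)"
proof -
  have "fourier_coeff (\<lambda>z. cnj z * f (cnj z) $ i) k = fourier_coeff (\<lambda>z. f z $ i) (- k - 1)" for i
  proof -
    have "(\<lambda>z. z * f z $ i) \<in> borel_measurable circle"
      using L2_measurable[OF Linf_mult_L2[OF Linf_powi[of 1] L2_vec_entry[OF assms]]] by simp
    from fourier_coeff_reflect[OF this, of k] show ?thesis
      using fourier_coeff_shift[of 1 "\<lambda>z. f z $ i" "- k"] by simp
  qed
  then show ?thesis by (simp add: vcoeff_def reflect_def vec_eq_iff)
qed

lemma vcoeff_cong_AE:
  assumes "f \<in> L2_vec" "g \<in> L2_vec" "AE z in circle. f z = g z"
  shows "vcoeff f k = vcoeff g k"
proof -
  have "fourier_coeff (\<lambda>z. f z $ i) k = fourier_coeff (\<lambda>z. g z $ i) k" for i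
    by (rule fourier_coeff_cong_AE) (use assms in \<open>auto intro: L2_measurable L2_vec_entry\<close>)
  then show ?thesis by (simp add: vcoeff_def)
qed

lemma vcoeff_mult_cong_AE:
  assumes "F \<in> Linf_mat" "f \<in> L2_vec" "g \<in> L2_vec" "AE z in circle. f z = g z"
  shows "vcoeff (\<lambda>z. F z *v f z) k = vcoeff (\<lambda>z. F z *v g z) k"
  by (rule vcoeff_cong_AE) (use assms in \<open>auto intro: L2_vec_mult\<close>)

lemma L2_vec_eq_AE:
  assumes "f \<in> L2_vec" "g \<in> L2_vec" "\<And>k. vcoeff f k = vcoeff g k"
  shows "AE z in circle. f z = g z"
proof -
  have "AE z in circle. f z $ i = g z $ i" for i
    using assms by (intro L2_eq_AE L2_vec_entry) (auto simp: vcoeff_def vec_eq_iff)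
  then have "AE z in circle. \<forall>i. f z $ i = g z $ i" by (simp add: AE_all_countable)
  then show ?thesis by (simp add: vec_eq_iff)
qed

lemma H2_vec_iff: "f \<in> H2_vec \<longleftrightarrow> f \<in> L2_vec \<and> (\<forall>k<0. vcoeff f k = 0)"
  by (auto simp: H2_vec_def H2_def L2_vec_def vcoeff_def vec_eq_iff)

lemma
  assumes f: "f \<in> L2_vec"
  shows proj_vec_in: "proj_vec f \<in> H2_vec"
    and vcoeff_proj: "vcoeff (proj_vec f) k = (if k \<ge> 0 then vcoeff f k else 0)"
  using proj_H2[OF L2_vec_entry[OF f]]
  by (simp_all add: H2_vec_def proj_vec_def vcoeff_def vec_eq_iff)

lemma mcoeff_add:
  "F \<in> Linf_mat \<Longrightarrow> G \<in> Linf_mat \<Longrightarrow> mcoeff (\<lambda>z. F z + G z) k = mcoeff F k + mcoeff G k"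
  by (simp add: mcoeff_def vec_eq_iff fourier_coeff_add Linf_L2 Linf_mat_entry)

lemma mcoeff_diff:
  "F \<in> Linf_mat \<Longrightarrow> G \<in> Linf_mat \<Longrightarrow> mcoeff (\<lambda>z. F z - G z) k = mcoeff F k - mcoeff G k"
  by (simp add: mcoeff_def vec_eq_iff fourier_coeff_diff Linf_L2 Linf_mat_entry)

lemma mcoeff_const_mult: "F \<in> Linf_mat \<Longrightarrow> mcoeff (\<lambda>z. A ** F z) k = A ** mcoeff F k"
  by (simp add: mcoeff_def vec_eq_iff matrix_matrix_mult_def fourier_coeff_sum L2_scale
      fourier_coeff_scale Linf_L2 Linf_mat_entry)

lemma mcoeff_mult_const: "F \<in> Linf_mat \<Longrightarrow> mcoeff (\<lambda>z. F z ** A) k = mcoeff F k ** A"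
  by (simp add: mcoeff_def vec_eq_iff matrix_matrix_mult_def fourier_coeff_sum L2_scale
      fourier_coeff_scale Linf_L2 Linf_mat_entry mult.commute[of _ "A $ _ $ _"])

lemma mcoeff_conj_transpose: "mcoeff (\<lambda>z. conj_transpose (F z)) k = conj_transpose (mcoeff F (- k))"
  by (simp add: mcoeff_def vec_eq_iff conj_transpose_def fourier_coeff_cnj)

lemma mcoeff_reflect: "F \<in> Linf_mat \<Longrightarrow> mcoeff (\<lambda>z. F (cnj z)) k = mcoeff F (- k)"
  using fourier_coeff_reflect[OF L2_measurable[OF Linf_L2[OF Linf_mat_entry[of F]]]]
  by (auto simp: mcoeff_def vec_eq_iff)

lemma analytic_mat_iff: "F \<in> Linf_mat \<Longrightarrow> analytic_mat F \<longleftrightarrow> (\<forall>k<0. mcoeff F k = 0)"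
  by (auto simp: analytic_mat_def mcoeff_def vec_eq_iff L2_integrable Linf_L2 Linf_mat_entry)

text \<open>Convolution of series is avoided: the coefficient is the inner product of
  \<open>f\<close> with \<open>z powi k * cnj (a z)\<close>, whose coefficient at m >= 0 is the
  conjugate of that of \<open>a\<close> at the negative index k - m.\<close>

lemma fourier_coeff_analytic_mult:
  assumes "a \<in> Linf" "\<And>k. k < 0 \<Longrightarrow> fourier_coeff a k = 0" "f \<in> H2" "k < 0"
  shows "fourier_coeff (\<lambda>z. a z * f z) k = 0"
proof -
  have "L2_inner f (\<lambda>z. z powi k * cnj (a z)) = 0"
  proof (rule H2_orthogonal[OF assms(3)])
    show "(\<lambda>z. z powi k * cnj (a z)) \<in> L2"
      by (intro Linf_mult_L2 Linf_powi L2_cnj Linf_L2 assms)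
  qed (use assms in \<open>simp add: fourier_coeff_shift fourier_coeff_cnj\<close>)
  then show ?thesis by (simp add: fourier_coeff_def L2_inner_def mult_ac)
qed

lemma vcoeff_analytic_mult:
  assumes F: "F \<in> Linf_mat" "analytic_mat F" and f: "f \<in> H2_vec" and k: "k < 0"
  shows "vcoeff (\<lambda>z. F z *v f z) k = 0"
proof -
  have "fourier_coeff (\<lambda>z. F z $ i $ j * f z $ j) k = 0" for i j
    by (rule fourier_coeff_analytic_mult)
       (use F f k in \<open>auto simp: analytic_mat_def H2_vec_def intro: Linf_mat_entry\<close>)
  then show ?thesis
    using F f by (simp add: vcoeff_def vec_eq_iff matrix_vector_mult_def fourier_coeff_sum Linf_mult_L2
        Linf_mat_entry L2_vec_entry H2_vec_iff)
qed

section \<open>Toeplitz and Hankel operators\<close>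

lemma
  assumes "F \<in> Linf_mat" "h \<in> L2_vec"
  shows toeplitz_in: "toeplitz F h \<in> H2_vec"
    and vcoeff_toeplitz: "vcoeff (toeplitz F h) k = (if k \<ge> 0 then vcoeff (\<lambda>z. F z *v h z) k else 0)"
  unfolding toeplitz_def using assms by (simp_all add: proj_vec_in vcoeff_proj L2_vec_mult)

lemma hankel_reflect: "hankel F h = proj_vec (reflect (\<lambda>z. F z *v h z))"
  by (simp add: hankel_def reflect_def[abs_def])

lemma
  assumes "F \<in> Linf_mat" "h \<in> L2_vec"
  shows hankel_in: "hankel F h \<in> H2_vec"
    and vcoeff_hankel: "vcoeff (hankel F h) k = (if k \<ge> 0 then vcoeff (\<lambda>z. F z *v h z) (- k - 1) else 0)"
  unfolding hankel_reflect using assms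
  by (simp_all add: proj_vec_in vcoeff_proj L2_vec_mult L2_vec_reflect vcoeff_reflect)

lemma L2_vec_inner_proj_left:
  assumes "f \<in> L2_vec" "h \<in> H2_vec"
  shows "L2_vec_inner (proj_vec f) h = L2_vec_inner f h"
  using assms by (simp add: L2_vec_inner_def proj_vec_def proj_H2_inner L2_vec_entry H2_vec_def)

lemma L2_vec_inner_cnj: "cnj (L2_vec_inner f h) = L2_vec_inner h f"
  by (simp add: L2_vec_inner_def L2_inner_cnj)

lemma L2_inner_sum_right:
  "(\<And>i. i \<in> I \<Longrightarrow> f i \<in> L2) \<Longrightarrow> h \<in> L2 \<Longrightarrow> L2_inner h (\<lambda>z. \<Sum>i\<in>I. f i z) = (\<Sum>i\<in>I. L2_inner h (f i))"
  by (subst L2_inner_cnj[symmetric]) (simp add: L2_inner_sum_left L2_inner_cnj)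

lemma L2_vec_inner_adjoint:
  assumes "F \<in> Linf_mat" "f \<in> L2_vec" "h \<in> L2_vec"
  shows "L2_vec_inner (\<lambda>z. F z *v f z) h = L2_vec_inner f (\<lambda>z. conj_transpose (F z) *v h z)"
proof -
  have "L2_inner (\<lambda>z. F z $ i $ j * f z $ j) (\<lambda>z. h z $ i)
    = L2_inner (\<lambda>z. f z $ j) (\<lambda>z. cnj (F z $ i $ j) * h z $ i)" for i j
    by (simp add: L2_inner_def mult_ac)
  then have "L2_vec_inner (\<lambda>z. F z *v f z) h
    = (\<Sum>i\<in>UNIV. \<Sum>j\<in>UNIV. L2_inner (\<lambda>z. f z $ j) (\<lambda>z. cnj (F z $ i $ j) * h z $ i))"
    using assms by (simp add: L2_vec_inner_def matrix_vector_mult_def L2_inner_sum_left Linf_mult_L2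
        Linf_mat_entry L2_vec_entry)
  also have "\<dots> = (\<Sum>j\<in>UNIV. \<Sum>i\<in>UNIV. L2_inner (\<lambda>z. f z $ j) (\<lambda>z. cnj (F z $ i $ j) * h z $ i))"
    by (rule sum.swap)
  also have "\<dots> = L2_vec_inner f (\<lambda>z. conj_transpose (F z) *v h z)"
    using assms
      by (simp add: L2_vec_inner_def matrix_vector_mult_def conj_transpose_def L2_inner_sum_right
        Linf_mult_L2
        Linf_cnj Linf_mat_entry L2_vec_entry)
  finally show ?thesis .
qed

text \<open>These test functions read off a single entry of a single coefficient, which is how the
  adjoint is identified.\<close>

lemma L2_vec_inner_powi_axis:
  "L2_vec_inner (\<lambda>z. z powi m *s axis i 1) k = cnj (vcoeff k m $ i)"
proof -
  have "L2_inner (\<lambda>z. z powi m * axis i 1 $ j) (\<lambda>z. k z $ j)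
    = (if j = i then cnj (vcoeff k m $ i) else 0)" for j
    by (auto simp: axis_def vcoeff_def fourier_coeff_inner L2_inner_cnj) (simp add: L2_inner_def)
  then show ?thesis by (simp add: L2_vec_inner_def)
qed

lemma powi_vec_H2: "m \<ge> 0 \<Longrightarrow> (\<lambda>z. z powi m *s v) \<in> H2_vec"
  by (simp add: H2_vec_iff L2_vec_shift L2_vec_const vcoeff_shift vcoeff_const)

text \<open>The Toeplitz operator of the pointwise adjoint is a witness for the choice in
  \<open>op_adjoint\<close>. The chosen function may be another representative, but pairing both
  with \<open>z powi k *s axis i 1\<close> shows that their coefficients agree.\<close>

lemma op_adjoint_toeplitz:
  assumes F: "F \<in> Linf_mat" and h: "h \<in> H2_vec"
  shows op_adjoint_toeplitz_in: "op_adjoint (toeplitz F) h \<in> H2_vec"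
    and vcoeff_op_adjoint_toeplitz: "vcoeff (op_adjoint (toeplitz F) h) k
      = (if k \<ge> 0 then vcoeff (\<lambda>z. conj_transpose (F z) *v h z) k else 0)"
proof -
  let ?k = "toeplitz (\<lambda>z. conj_transpose (F z)) h" and ?K = "op_adjoint (toeplitz F) h"
  note F' = Linf_mat_conj_transpose[OF F]
  have h': "h \<in> L2_vec" using h by (simp add: H2_vec_iff)
  have 1: "?k \<in> H2_vec \<and> (\<forall>g\<in>H2_vec. L2_vec_inner (toeplitz F g) h = L2_vec_inner g ?k)"
  proof (intro conjI ballI)
    show "?k \<in> H2_vec" by (rule toeplitz_in[OF F' h'])
    fix g :: "complex \<Rightarrow> complex^'a" assume g: "g \<in> H2_vec"
    then have g': "g \<in> L2_vec" by (simp add: H2_vec_iff)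
    have "L2_vec_inner (toeplitz F g) h = L2_vec_inner g (\<lambda>z. conj_transpose (F z) *v h z)"
      by (simp add: toeplitz_def L2_vec_inner_proj_left L2_vec_mult F g' h L2_vec_inner_adjoint h')
    also have "\<dots> = cnj (L2_vec_inner ?k g)"
      by (simp add: toeplitz_def L2_vec_inner_proj_left L2_vec_mult F' g h' L2_vec_inner_cnj)
    finally show "L2_vec_inner (toeplitz F g) h = L2_vec_inner g ?k"
      by (simp add: L2_vec_inner_cnj)
  qed
  then have 2: "?K \<in> H2_vec \<and> (\<forall>g\<in>H2_vec. L2_vec_inner (toeplitz F g) h = L2_vec_inner g ?K)"
    unfolding op_adjoint_def
    by (rule someI[where P = "\<lambda>k. k \<in> H2_vec
      \<and> (\<forall>g\<in>H2_vec. L2_vec_inner (toeplitz F g) h = L2_vec_inner g k)"])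
  then show in_H2: "?K \<in> H2_vec" by blast
  show "vcoeff ?K k = (if k \<ge> 0 then vcoeff (\<lambda>z. conj_transpose (F z) *v h z) k else 0)"
  proof (cases "k \<ge> 0")
    case True
    have "vcoeff ?K k $ i = vcoeff ?k k $ i" for i
    proof -
      have "L2_vec_inner (\<lambda>z. z powi k *s axis i 1) ?K = L2_vec_inner (\<lambda>z. z powi k *s axis i 1) ?k"
        using bspec[OF conjunct2[OF 1] powi_vec_H2[OF True, of "axis i 1"]]
          bspec[OF conjunct2[OF 2] powi_vec_H2[OF True, of "axis i 1"]] by (rule trans[OF sym, rotated])
      then show ?thesis by (simp add: L2_vec_inner_powi_axis)
    qed
    then show ?thesis using True by (simp add: vec_eq_iff vcoeff_toeplitz F' h')
  qed (use in_H2 in \<open>simp add: H2_vec_iff\<close>)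
qed

section \<open>Commuting a constant matrix out of the kernel conditions\<close>

text \<open>A maximal independent set \<open>B\<close> of rows spans all rows and has at most as
  many elements as a square matrix has rows. A vector killed by a square matrix containing
  \<open>B\<close> among its rows is killed by every \<open>X i\<close>, so that matrix has trivial
  kernel.\<close>

lemma left_inverse_of_rows:
  fixes X :: "'i \<Rightarrow> 'a::field^'n^'m"
  assumes "\<And>c. (\<And>i. X i *v c = 0) \<Longrightarrow> c = 0"
  obtains p :: "'n \<Rightarrow> 'i" and q :: "'n \<Rightarrow> 'm" and C :: "'a^'n^'n"
  where "C ** (\<chi> a. X (p a) $ q a) = mat 1"
proof -
  define R where "R = {X i $ q |i q. True}"
  obtain B where B: "B \<subseteq> R" "vec.independent B" "R \<subseteq> vec.span B"
    using vec.maximal_independent_subset[of R] by blast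
  have "finite B" using B(2) by (rule vec.finiteI_independent)
  have "card B \<le> vec.dim (UNIV :: ('a^'n) set)"
    by (rule vec.independent_card_le_dim) (use B in auto)
  then have "card B \<le> CARD('n)" by (simp only: vec_dim_card)
  then obtain f :: "'a^'n \<Rightarrow> 'n" where f: "inj_on f B"
    using card_le_inj[OF \<open>finite B\<close> finite_class.finite_UNIV] by blast
  \<comment> \<open>\<open>f\<close> assigns slots to the elements of \<open>B\<close>; the
    remaining slots receive an arbitrary row, which keeps every \<open>r a\<close> in
    \<open>R\<close>.\<close>
  define r where "r a = (if a \<in> f ` B then the_inv_into B f a else X undefined $ undefined)" for a
  have "r a \<in> R" for a
    using B(1) the_inv_into_into[OF f _ order_refl, of a] by (auto simp: r_def R_def)
  then have "\<forall>a. \<exists>i q. r a = X i $ q" by (auto simp: R_def)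
  then obtain p q where pq: "\<And>a. r a = X (p a) $ q a" by metis
  have "x = 0" if "(\<chi> a. r a) *v x = 0" for x
  proof (rule assms)
    fix i
    \<comment> \<open>The rows annihilating \<open>x\<close> form a subspace; as it contains
      \<open>B\<close>, it contains every row of every \<open>X i\<close>.\<close>
    define V where "V = {v :: 'a^'n. (\<Sum>j\<in>UNIV. v $ j * x $ j) = 0}"
    have "b \<in> V" if "b \<in> B" for b
    proof -
      have "r (f b) = b" using that by (simp add: r_def the_inv_into_f_f[OF f])
      moreover have "((\<chi> a. r a) *v x) $ f b = 0" using \<open>(\<chi> a. r a) *v x = 0\<close> by simp
      ultimately show ?thesis by (simp add: V_def matrix_vector_mult_def)
    qed
    moreover have "vec.subspace V"
      by (auto simp: V_def vec.subspace_def distrib_right sum.distrib mult.assoc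
        sum_distrib_left[symmetric])
    ultimately have "vec.span B \<subseteq> V" by (intro vec.span_minimal) auto
    then have "X i $ q \<in> V" for q using B(3) by (auto simp: R_def)
    then show "X i *v x = 0" by (simp add: V_def matrix_vector_mult_def vec_eq_iff)
  qed
  then have "\<exists>C. C ** (\<chi> a. r a) = mat 1"
    by (intro iffD2[OF matrix_left_invertible_ker] allI impI)
  then obtain C where "C ** (\<chi> a. r a) = mat 1" ..
  then show thesis using that[of C p q] pq by simp
qed

lemma conj_transpose_conj_transpose [simp]: "conj_transpose (conj_transpose A) = A"
  by (simp add: conj_transpose_def vec_eq_iff)

lemma conj_transpose_mult: "conj_transpose (A ** B) = conj_transpose B ** conj_transpose A"
  by (simp add: conj_transpose_def vec_eq_iff matrix_matrix_mult_def mult.commute)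

text \<open>\<open>C\<close> inverts the matrix of chosen rows of the \<open>X i\<close>, so the
  same combination of rows of the \<open>Y i\<close> yields \<open>A\<close> and the first formula.
  For the second, the error \<open>D\<close> annihilates the adjoint of every \<open>X j\<close>;
  taking adjoints puts the columns of \<open>conj_transpose D\<close> into the common
  kernel.\<close>

lemma common_factor:
  fixes X Y :: "'i \<Rightarrow> complex^'n^'n"
  assumes ker: "\<And>c. (\<And>i. X i *v c = 0) \<Longrightarrow> c = 0"
    and XY: "\<And>i j. X i ** Y j = - (Y i ** conj_transpose (X j))"
  obtains A where "\<And>j. Y j = - (A ** conj_transpose (X j))" "\<And>i. Y i = X i ** A"
proof -
  obtain p :: "'n \<Rightarrow> 'i" and q :: "'n \<Rightarrow> 'n" and C :: "complex^'n^'n"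
    where C: "C ** (\<chi> a. X (p a) $ q a) = mat 1"
  proof (rule left_inverse_of_rows[of X])
    show "c = 0" if "\<And>i. X i *v c = 0" for c using that by (rule ker)
  qed (rule that)
  define A where "A = C ** (\<chi> a. Y (p a) $ q a)"
  have 1: "Y j = - (A ** conj_transpose (X j))" for j
  proof -
    \<comment> \<open>Row \<open>a\<close> of this equation is row \<open>q a\<close> of
      \<open>XY\<close> for the index \<open>p a\<close>.\<close>
    have "(\<chi> a. X (p a) $ q a) ** Y j = - ((\<chi> a. Y (p a) $ q a) ** conj_transpose (X j))"
      using XY[of _ j] by (simp add: vec_eq_iff matrix_matrix_mult_def)
    then have "C ** ((\<chi> a. X (p a) $ q a) ** Y j)
      = C ** (- ((\<chi> a. Y (p a) $ q a) ** conj_transpose (X j)))"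
      by simp
    moreover have "C ** (- M) = - (C ** M)" for M :: "complex^'n^'n"
      by (simp add: vec_eq_iff matrix_matrix_mult_def sum_negf)
    ultimately show ?thesis
      by (simp add: matrix_mul_assoc C A_def)
  qed
  have "Y i = X i ** A" for i
  proof -
    define D where "D = X i ** A - Y i"
    have "D ** conj_transpose (X j) = 0" for j
    proof -
      have "X i ** Y j = - (X i ** (A ** conj_transpose (X j)))"
        unfolding 1[of j] by (simp add: vec_eq_iff matrix_matrix_mult_def sum_negf)
      moreover have "D ** Z = X i ** A ** Z - Y i ** Z" for Z :: "complex^'n^'n"
        by (simp add: D_def vec_eq_iff matrix_matrix_mult_def left_diff_distrib sum_subtractf)
      ultimately show ?thesis
        using XY[of i j] by (simp add: matrix_mul_assoc)
    qed
    then have "conj_transpose (D ** conj_transpose (X j)) = 0" for j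
      by (simp add: conj_transpose_def vec_eq_iff)
    then have XD: "X j ** conj_transpose D = 0" for j
      by (simp add: conj_transpose_mult)
    have "conj_transpose D *v v = 0" for v
      by (rule ker) (simp add: matrix_vector_mul_assoc XD)
    then have "conj_transpose D = 0" by (simp add: matrix_eq)
    then have "D = 0" by (simp add: conj_transpose_def vec_eq_iff)
    then show ?thesis by (simp add: D_def)
  qed
  with 1 show thesis by (rule that)
qed

section \<open>The intertwining relation\<close>

lemma minus_matrix_vector_mult: "(- A) *v x = - (A *v x)"
  for A :: "'a::ring_1^'n^'m"
  by (simp add: matrix_vector_mult_def vec_eq_iff sum_negf)

lemma matrix_vector_mult_minus: "A *v (- x) = - (A *v x)"
  for A :: "'a::ring_1^'n^'m"
  by (simp add: matrix_vector_mult_def vec_eq_iff sum_negf)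

lemma vcoeff_minus: "vcoeff (\<lambda>z. - f z) k = - vcoeff f k"
  using fourier_coeff_scale[of "-1" "\<lambda>z. f z $ _"] by (simp add: vcoeff_def vec_eq_iff)

text \<open>The factor \<open>cnj z\<close> lowers indices by one, so the coefficients kept by the
  projection are those of \<open>\<phi>\<close> from index 1 on. A common kernel vector is then a
  linear relation between the columns, which regularity excludes.\<close>

lemma regular_shift_kernel:
  assumes phi: "\<phi> \<in> Linf_mat"
    and reg: "regular_mat (proj_mat (\<lambda>z. scalar_mat (cnj z) (\<phi> z)))"
    and c: "\<And>i :: nat. mcoeff \<phi> (int i + 1) *v c = 0"
  shows "c = 0"
proof -
  let ?F = "proj_mat (\<lambda>z. scalar_mat (cnj z) (\<phi> z))"
  have F: "(\<lambda>z. ?F z $ a $ b) \<in> L2" for a b using reg by (simp add: regular_mat_def)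
  have L2: "(\<lambda>z. cnj z * \<phi> z $ a $ b) \<in> L2" for a b
    using Linf_mult_L2[OF Linf_cnj[OF Linf_powi[of 1]] Linf_L2[OF Linf_mat_entry[OF phi]]] by simp
  have "fourier_coeff (\<lambda>z. cnj z * \<phi> z $ a $ b) k = fourier_coeff (\<lambda>z. \<phi> z $ a $ b) (k + 1)" for a b k
  proof -
    have "fourier_coeff (\<lambda>z. cnj z * \<phi> z $ a $ b) k = fourier_coeff (\<lambda>z. z powi (-1) * \<phi> z $ a $ b) k"
      unfolding fourier_coeff_def
    proof (rule Bochner_Integration.integral_cong[OF refl])
      fix z assume "z \<in> space circle"
      then show "cnj z * \<phi> z $ a $ b * cnj (z powi k) = z powi (-1) * \<phi> z $ a $ b * cnj (z powi k)"
        using cnj_powi_circle[of z 1] by simp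
    qed
    then show ?thesis by (simp only: fourier_coeff_shift) simp
  qed
  then have coeff: "mcoeff ?F k = (if k \<ge> 0 then mcoeff \<phi> (k + 1) else 0)" for k
    by (simp add: mcoeff_def vec_eq_iff proj_mat_def scalar_mat_def fourier_coeff_proj L2)
  have "AE z in circle. ?F z *v c = 0"
  proof (rule L2_vec_eq_AE)
    show "(\<lambda>z. ?F z *v c) \<in> L2_vec"
      using L2_scale[OF F]
        by (simp add: L2_vec_def matrix_vector_mult_def L2_sum mult.commute[of _ "c $ _"])
    show "vcoeff (\<lambda>z. ?F z *v c) k = vcoeff (\<lambda>z. 0) k" for k
      using c[of "nat k"] by (cases "k \<ge> 0") (simp_all add: vcoeff_mult_const F coeff vcoeff_const)
  qed (rule L2_vec_const)
  then have "\<forall>j. c $ j = 0"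
    using reg by (simp add: regular_mat_def matrix_mult_sum)
  then show ?thesis by (simp add: vec_eq_iff)
qed

text \<open>Splitting off a constant term trades an infinite convolution sum for one matrix product
  and a coefficient of another product with index lowered by one.\<close>

lemma vcoeff_shift_decomposition:
  assumes "F \<in> Linf_mat" "f \<in> L2_vec" "g \<in> L2_vec" "AE z in circle. f z = c + z *s g z"
  shows "vcoeff (\<lambda>z. F z *v f z) k = mcoeff F k *v c + vcoeff (\<lambda>z. F z *v g z) (k - 1)"
proof -
  have g: "(\<lambda>z. z *s g z) \<in> L2_vec" using L2_vec_shift[OF assms(3), of 1] by simp
  have "vcoeff (\<lambda>z. F z *v f z) k = vcoeff (\<lambda>z. F z *v (c + z *s g z)) k"
    by (intro vcoeff_mult_cong_AE assms L2_vec_add L2_vec_const g)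
  also have "\<dots> = vcoeff (\<lambda>z. F z *v c + z powi 1 *s (F z *v g z)) k"
    by (simp add: matrix_vector_right_distrib vector_scalar_commute)
  also have "\<dots> = mcoeff F k *v c + vcoeff (\<lambda>z. F z *v g z) (k - 1)"
    by (subst vcoeff_add)
       (auto simp: vcoeff_mult_const vcoeff_shift Linf_L2 Linf_mat_entry assms L2_vec_mult
         L2_vec_const simp del: power_int_1_right
         intro!: L2_vec_shift)
  finally show ?thesis .
qed

text \<open>Passing from z^j to z^(j+1) shifts the Hankel image down and the adjoint Toeplitz image
  up. Using the relation for \<open>j\<close> at index \<open>i + 1\<close> and for
  \<open>j + 1\<close> at index \<open>i\<close> therefore leaves the same unevaluated coefficient
  on both sides.\<close>

lemma intertwining_recursion:
  assumes phi: "\<phi> \<in> Linf_mat" and psi: "\<psi> \<in> Linf_mat"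
    and eq: "\<And>h k. h \<in> H2_vec
      \<Longrightarrow> vcoeff (toeplitz \<phi> (hankel \<psi> h)) k = vcoeff (hankel \<psi> (op_adjoint (toeplitz \<phi>) h)) k"
  shows "mcoeff \<phi> (int i + 1) ** mcoeff \<psi> (- int j - 1)
    = - (mcoeff \<psi> (- int i - 1) ** conj_transpose (mcoeff \<phi> (int j + 1)))"
proof -
  have "mcoeff \<phi> (int i + 1) *v (mcoeff \<psi> (- int j - 1) *v v)
    = - (mcoeff \<psi> (- int i - 1) *v (conj_transpose (mcoeff \<phi> (int j + 1)) *v v))" for v
  proof -
    define e where "e j = (\<lambda>z::complex. z powi int j *s v)" for j :: nat
    define g where "g j = hankel \<psi> (e j)" for j
    define k where "k j = op_adjoint (toeplitz \<phi>) (e j)" for j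
    have e: "e j \<in> H2_vec" "e j \<in> L2_vec" for j
      using powi_vec_H2[of "int j" v] by (simp_all add: e_def H2_vec_iff)
    have e_mult: "vcoeff (\<lambda>z. F z *v e j z) m = mcoeff F (m - int j) *v v" if "F \<in> Linf_mat"
      for F :: "complex \<Rightarrow> complex^'a^'a" and j m
      by (simp add: e_def vector_scalar_commute vcoeff_shift vcoeff_mult_const Linf_L2
        Linf_mat_entry that del: power_int_of_nat)
    have g: "g j \<in> L2_vec" for j using hankel_in[OF psi e(2)] by (simp add: g_def H2_vec_iff)
    have k: "k j \<in> L2_vec" for j using op_adjoint_toeplitz_in[OF phi e(1)]
      by (simp add: k_def H2_vec_iff)
    have g_coeff: "vcoeff (g j) m = (if m \<ge> 0 then mcoeff \<psi> (- m - 1 - int j) *v v else 0)" for j m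
      by (simp add: g_def vcoeff_hankel psi e e_mult)
    have k_coeff: "vcoeff (k j) m
      = (if m \<ge> 0 then conj_transpose (mcoeff \<phi> (int j - m)) *v v else 0)" for j m
      by (simp add: k_def vcoeff_op_adjoint_toeplitz phi e e_mult Linf_mat_conj_transpose
        mcoeff_conj_transpose)
    have shift: "(\<lambda>z. c + z powi 1 *s f z) \<in> L2_vec"
      "vcoeff (\<lambda>z. c + z powi 1 *s f z) m = (if m = 0 then c else 0) + vcoeff f (m - 1)"
      if "f \<in> L2_vec" for f c m
      using that
        by (simp_all add: L2_vec_add L2_vec_const L2_vec_shift vcoeff_add vcoeff_const vcoeff_shift
          del: power_int_1_right)
    \<comment> \<open>Backward shift: \<open>g (Suc j)\<close> arises from \<open>g j\<close> by
      removing the constant coefficient and dividing by z.\<close>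
    have "AE z in circle. g j z = mcoeff \<psi> (- int j - 1) *v v + z powi 1 *s g (Suc j) z"
      by (rule L2_vec_eq_AE[OF g shift(1)[OF g]]) (simp add: shift(2)[OF g] g_coeff
        minus_diff_commute[of "int j" 1] del: power_int_1_right, auto simp: algebra_simps)
    then have G: "vcoeff (\<lambda>z. \<phi> z *v g j z) (int i + 1)
      = mcoeff \<phi> (int i + 1) *v (mcoeff \<psi> (- int j - 1) *v v)
        + vcoeff (\<lambda>z. \<phi> z *v g (Suc j) z) (int i)"
      using vcoeff_shift_decomposition[OF phi g g, of j "mcoeff \<psi> (- int j - 1) *v v" "Suc j"
        "int i + 1"] by simp
    \<comment> \<open>Here the shift runs the other way: \<open>k (Suc j)\<close> is built from
      \<open>k j\<close>.\<close>
    have "AE z in circle. k (Suc j) z = conj_transpose (mcoeff \<phi> (int j + 1)) *v v + z powi 1 *s k j z"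
      by (rule L2_vec_eq_AE[OF k shift(1)[OF k]]) (simp add: shift(2)[OF k] k_coeff
        del: power_int_1_right, auto simp: algebra_simps)
    then have K: "vcoeff (\<lambda>z. \<psi> z *v k (Suc j) z) (- int i - 1)
      = mcoeff \<psi> (- int i - 1) *v (conj_transpose (mcoeff \<phi> (int j + 1)) *v v)
        + vcoeff (\<lambda>z. \<psi> z *v k j z) (- int i - 2)"
      using vcoeff_shift_decomposition[OF psi k k, of "Suc j"
        "conj_transpose (mcoeff \<phi> (int j + 1)) *v v" j "- int i - 1"] by (simp add: minus_diff_commute)
    \<comment> \<open>The relation at \<open>e j\<close>; coefficient \<open>m\<close> of a Hankel
      image stems from index \<open>- m - 1\<close>.\<close>
    have GK: "vcoeff (\<lambda>z. \<phi> z *v g j z) (int m) = vcoeff (\<lambda>z. \<psi> z *v k j z) (- int m - 1)" for j m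
      using eq[OF e(1)[of j], of "int m"] vcoeff_toeplitz[OF phi g[of j]] vcoeff_hankel[OF psi k[of j]]
      by (simp add: g_def k_def)
    show ?thesis
      \<comment> \<open>Chaining the four equations, the coefficient of
        \<open>\<psi> z *v k j z\<close> at \<open>- i - 2\<close> occurs on both sides and
        cancels.\<close>
      using G K GK[of j "Suc i"] GK[of "Suc j" i]
        by (simp add: minus_diff_commute eq_neg_iff_add_eq_0 add_ac)
  qed
  then show ?thesis by (simp add: matrix_eq minus_matrix_vector_mult flip: matrix_vector_mul_assoc)
qed

text \<open>The computation of the outline, one coefficient at a time. Under (i) and (ii) the
  failure to intertwine is governed by the function in (iii) alone, which serves both directions of
  the theorem.\<close>

lemma intertwining_defect:
  assumes phi: "\<phi> \<in> Linf_mat" and psi: "\<psi> \<in> Linf_mat" and h: "h \<in> H2_vec"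
    and 1: "analytic_mat (\<lambda>z. \<psi> z - \<phi> (cnj z) ** A)"
    and 2: "analytic_mat (\<lambda>z. \<psi> z + A ** conj_transpose (\<phi> z))"
    and i: "i \<ge> 0"
  shows "vcoeff (hankel \<psi> (op_adjoint (toeplitz \<phi>) h)) i - vcoeff (toeplitz \<phi> (hankel \<psi> h)) i
    = vcoeff (\<lambda>z. (\<phi> (cnj z) ** A ** conj_transpose (\<phi> z)) *v h z) (- i - 1)"
proof -
  note intros = L2_vec_mult L2_vec_const_mult L2_vec_add L2_vec_reflect Linf_mat_mult Linf_mat_const
    Linf_mat_add Linf_mat_diff Linf_mat_conj_transpose Linf_mat_reflect[OF phi] phi psi
  \<comment> \<open>\<open>K\<close> carries the nonnegative frequencies of \<open>X\<close>, while
    \<open>Q\<close> carries its negative frequencies after the flip.\<close>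
  define X where "X z = conj_transpose (\<phi> z) *v h z" for z
  define K where "K = op_adjoint (toeplitz \<phi>) h"
  define Q where "Q = proj_vec (reflect X)"
  have h': "h \<in> L2_vec" using h by (simp add: H2_vec_iff)
  have X: "X \<in> L2_vec" unfolding X_def[abs_def] by (intro intros h')
  have K: "K \<in> H2_vec" "\<And>k. vcoeff K k = (if k \<ge> 0 then vcoeff X k else 0)"
    unfolding K_def X_def[abs_def] by (simp_all add: op_adjoint_toeplitz phi h)
  then have K': "K \<in> L2_vec" by (simp add: H2_vec_iff)
  have Q: "Q \<in> L2_vec" "\<And>k. vcoeff Q k = (if k \<ge> 0 then vcoeff X (- k - 1) else 0)"
    using proj_vec_in[OF L2_vec_reflect[OF X]]
    by (auto simp: Q_def H2_vec_iff vcoeff_proj L2_vec_reflect X vcoeff_reflect)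
  have reflect: "vcoeff (\<lambda>z. \<phi> (cnj z) *v (A *v f z)) (- i - 1)
    = vcoeff (\<lambda>z. \<phi> z *v (A *v reflect f z)) i"
    if "f \<in> L2_vec" for f
  proof -
    have "reflect (\<lambda>z. \<phi> (cnj z) *v (A *v f z)) = (\<lambda>z. \<phi> z *v (A *v reflect f z))"
      by (simp add: reflect_def[abs_def] vector_scalar_commute)
    then show ?thesis
      using vcoeff_reflect[of "\<lambda>z. \<phi> (cnj z) *v (A *v f z)" i] that by (simp add: intros)
  qed
  \<comment> \<open>By (ii), \<open>\<psi>\<close> may be replaced by minus \<open>A\<close> times
    the adjoint of \<open>\<phi>\<close> inside the Hankel operator; the constant \<open>A\<close>
    then moves out of the flip and the projection.\<close>
  have "AE z in circle. hankel \<psi> h z = (- A) *v Q z"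
  proof (rule L2_vec_eq_AE)
    show "hankel \<psi> h \<in> L2_vec" using hankel_in[OF psi h'] by (simp add: H2_vec_iff)
    show "(\<lambda>z. (- A) *v Q z) \<in> L2_vec" by (intro intros Q)
    show "vcoeff (hankel \<psi> h) k = vcoeff (\<lambda>z. (- A) *v Q z) k" for k
    proof (cases "k \<ge> 0")
      case True
      have "0 = vcoeff (\<lambda>z. (\<psi> z + A ** conj_transpose (\<phi> z)) *v h z) (- k - 1)"
        by (rule sym, rule vcoeff_analytic_mult[OF _ 2 h]) (use True in \<open>auto intro!: intros\<close>)
      also have "\<dots> = vcoeff (\<lambda>z. \<psi> z *v h z + A *v X z) (- k - 1)"
        by (simp add: matrix_vector_mult_add_rdistrib X_def flip: matrix_vector_mul_assoc)
      also have "\<dots> = vcoeff (\<lambda>z. \<psi> z *v h z) (- k - 1) + A *v vcoeff X (- k - 1)"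
        by (simp add: vcoeff_add vcoeff_const_mult intros h' X)
      finally have "vcoeff (\<lambda>z. \<psi> z *v h z) (- k - 1) = - (A *v vcoeff X (- k - 1))"
        by (simp add: eq_neg_iff_add_eq_0)
      then show ?thesis
        using True
          by (simp add: vcoeff_hankel psi h' vcoeff_const_mult Q minus_matrix_vector_mult vcoeff_minus)
    qed (simp add: vcoeff_hankel psi h' vcoeff_const_mult Q)
  qed
  then have "vcoeff (\<lambda>z. \<phi> z *v hankel \<psi> h z) i = vcoeff (\<lambda>z. \<phi> z *v ((- A) *v Q z)) i"
    using hankel_in[OF psi h'] by (intro vcoeff_mult_cong_AE intros Q) (auto simp: H2_vec_iff)
  also have "\<dots> = - vcoeff (\<lambda>z. \<phi> z *v (A *v Q z)) i"
    by (simp add: minus_matrix_vector_mult matrix_vector_mult_minus vcoeff_minus)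
  finally have L: "vcoeff (toeplitz \<phi> (hankel \<psi> h)) i = - vcoeff (\<lambda>z. \<phi> z *v (A *v Q z)) i"
    using hankel_in[OF psi h'] i by (simp add: vcoeff_toeplitz phi H2_vec_iff)
  \<comment> \<open>By (i), \<open>\<psi>\<close> may be replaced by
    \<open>\<phi> (cnj z) ** A\<close> here: the difference sends \<open>K\<close> to a function
    without negative frequencies.\<close>
  have "vcoeff (\<lambda>z. \<psi> z *v K z) (- i - 1) =
      vcoeff (\<lambda>z. (\<psi> z - \<phi> (cnj z) ** A) *v K z + \<phi> (cnj z) *v (A *v K z)) (- i - 1)"
    by (simp add: matrix_vector_mult_diff_rdistrib matrix_vector_mul_assoc)
  also have "\<dots> = vcoeff (\<lambda>z. (\<psi> z - \<phi> (cnj z) ** A) *v K z) (- i - 1)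
    + vcoeff (\<lambda>z. \<phi> (cnj z) *v (A *v K z)) (- i - 1)"
    by (intro vcoeff_add intros K')
  also have "vcoeff (\<lambda>z. (\<psi> z - \<phi> (cnj z) ** A) *v K z) (- i - 1) = 0"
    by (rule vcoeff_analytic_mult[OF _ 1 K(1)]) (use i in \<open>auto intro!: intros\<close>)
  finally have R: "vcoeff (hankel \<psi> K) i = vcoeff (\<lambda>z. \<phi> z *v (A *v reflect K z)) i"
    using i by (simp add: vcoeff_hankel psi K' reflect)
  \<comment> \<open>This is JP + PJ = J: at index \<open>k\<close> exactly one summand contributes
    the coefficient of \<open>X\<close> at \<open>- k - 1\<close>, namely \<open>Q\<close> for
    \<open>k >= 0\<close> and \<open>reflect K\<close> for \<open>k < 0\<close>.\<close>
  have "AE z in circle. reflect K z + Q z = reflect X z"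
    by (rule L2_vec_eq_AE) (auto simp: vcoeff_add intros K' Q X vcoeff_reflect K)
  then have "AE z in circle. A *v (reflect K z + Q z) = A *v reflect X z"
    by eventually_elim simp
  then have "vcoeff (\<lambda>z. \<phi> z *v (A *v (reflect K z + Q z))) i = vcoeff (\<lambda>z. \<phi> z *v (A *v reflect X z)) i"
    by (intro vcoeff_mult_cong_AE intros K' Q X)
  also have "vcoeff (\<lambda>z. \<phi> z *v (A *v (reflect K z + Q z))) i
      = vcoeff (\<lambda>z. \<phi> z *v (A *v reflect K z)) i + vcoeff (\<lambda>z. \<phi> z *v (A *v Q z)) i"
    by (simp add: matrix_vector_right_distrib vcoeff_add intros K' Q)
  also have "vcoeff (\<lambda>z. \<phi> z *v (A *v reflect X z)) i = vcoeff (\<lambda>z. \<phi> (cnj z) *v (A *v X z)) (- i - 1)"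
    by (rule reflect[OF X, symmetric])
  finally show ?thesis
    using L R by (simp add: K_def X_def matrix_vector_mul_assoc matrix_mul_assoc)
qed

theorem theorem2p7:
  fixes \<phi> \<psi> :: "complex \<Rightarrow> complex^'n^'n"
  assumes "\<phi> \<in> Linf_mat" and "\<psi> \<in> Linf_mat"
    and "regular_mat (proj_mat (\<lambda>z. scalar_mat (cnj z) (\<phi> z)))"
  shows "(\<forall>h\<in>H2_vec. AE z in circle.
            toeplitz \<phi> (hankel \<psi> h) z = hankel \<psi> (op_adjoint (toeplitz \<phi>) h) z)
     \<longleftrightarrow> (\<exists>A :: complex^'n^'n.
            analytic_mat (\<lambda>z. \<psi> z - \<phi> (cnj z) ** A) \<and>
            analytic_mat (\<lambda>z. \<psi> z + A ** conj_transpose (\<phi> z)) \<and>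
            analytic_mat (\<lambda>z. \<phi> (cnj z) ** A ** conj_transpose (\<phi> z)))"
proof -
  note phi = assms(1) and psi = assms(2)
  let ?L = "\<lambda>h. toeplitz \<phi> (hankel \<psi> h)" and ?R = "\<lambda>h. hankel \<psi> (op_adjoint (toeplitz \<phi>) h)"
  have in_H2: "?L h \<in> H2_vec" "?R h \<in> H2_vec" if "h \<in> H2_vec" for h
    using toeplitz_in[OF phi, of "hankel \<psi> h"] hankel_in[OF psi, of h]
      hankel_in[OF psi, of "op_adjoint (toeplitz \<phi>) h"] op_adjoint_toeplitz_in[OF phi that] that
    by (auto simp: H2_vec_iff)
  have L2: "(\<lambda>z. \<phi> (cnj z) ** A ** conj_transpose (\<phi> z)) \<in> Linf_mat" for A
    by (intro Linf_mat_mult Linf_mat_reflect[OF phi] Linf_mat_conj_transpose Linf_mat_const phi)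
  show ?thesis
  proof
    assume asm: "\<forall>h\<in>H2_vec. AE z in circle. ?L h z = ?R h z"
    have eq: "vcoeff (?L h) k = vcoeff (?R h) k" if "h \<in> H2_vec" for h k
      using asm in_H2[OF that] that by (intro vcoeff_cong_AE) (auto simp: H2_vec_iff)
    \<comment> \<open>As \<open>j\<close> runs over the natural numbers, \<open>- int j - 1\<close>
      covers exactly the negative indices, so these formulas are (ii) and (i)
      coefficientwise.\<close>
    obtain A where A: "\<And>j :: nat. mcoeff \<psi> (- int j - 1)
      = - (A ** conj_transpose (mcoeff \<phi> (int j + 1)))"
      "\<And>j :: nat. mcoeff \<psi> (- int j - 1) = mcoeff \<phi> (int j + 1) ** A"
    proof (rule common_factor[of "\<lambda>i :: nat. mcoeff \<phi> (int i + 1)" "\<lambda>i. mcoeff \<psi> (- int i - 1)"])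
      show "c = 0" if "\<And>i :: nat. mcoeff \<phi> (int i + 1) *v c = 0" for c
        using that by (rule regular_shift_kernel[OF phi assms(3)])
    qed (rule intertwining_recursion[OF phi psi eq], assumption, rule that)
    have neg: "\<exists>j :: nat. k = - int j - 1" if "k < 0" for k
      using that by (intro exI[of _ "nat (- k - 1)"]) auto
    have 1: "analytic_mat (\<lambda>z. \<psi> z - \<phi> (cnj z) ** A)"
      by (subst analytic_mat_iff)
         (auto dest!: neg intro!: Linf_mat_diff Linf_mat_mult Linf_mat_reflect[OF phi]
           Linf_mat_const phi psi
           simp: mcoeff_diff mcoeff_mult_const mcoeff_reflect A(2) Linf_mat_mult
            Linf_mat_reflect[OF phi] Linf_mat_const phi psi add.commute)
    have 2: "analytic_mat (\<lambda>z. \<psi> z + A ** conj_transpose (\<phi> z))"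
      by (subst analytic_mat_iff)
         (auto dest!: neg intro!: Linf_mat_add Linf_mat_mult Linf_mat_conj_transpose Linf_mat_const
           phi psi
           simp: mcoeff_add mcoeff_const_mult mcoeff_conj_transpose A(1) Linf_mat_mult
             Linf_mat_conj_transpose Linf_mat_const phi psi add.commute)
    have "mcoeff (\<lambda>z. \<phi> (cnj z) ** A ** conj_transpose (\<phi> z)) k *v v = 0" if "k < 0" for k v
    proof -
      \<comment> \<open>Constant test functions suffice: a coefficient of \<open>F z *v v\<close> is
        the coefficient of \<open>F\<close> applied to \<open>v\<close>, and \<open>v\<close> is
        arbitrary.\<close>
      have v: "(\<lambda>z. v) \<in> H2_vec" using powi_vec_H2[of 0 v] by simp
      have "vcoeff (\<lambda>z. (\<phi> (cnj z) ** A ** conj_transpose (\<phi> z)) *v v) k = 0"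
        using intertwining_defect[OF phi psi v 1 2, of "- k - 1"] eq[OF v] that by simp
      then show ?thesis using L2[of A] by (simp add: vcoeff_mult_const Linf_L2 Linf_mat_entry)
    qed
    then have 3: "analytic_mat (\<lambda>z. \<phi> (cnj z) ** A ** conj_transpose (\<phi> z))"
      by (simp add: analytic_mat_iff L2 matrix_eq)
    from 1 2 3 show "\<exists>A. analytic_mat (\<lambda>z. \<psi> z - \<phi> (cnj z) ** A) \<and>
        analytic_mat (\<lambda>z. \<psi> z + A ** conj_transpose (\<phi> z)) \<and>
        analytic_mat (\<lambda>z. \<phi> (cnj z) ** A ** conj_transpose (\<phi> z))" by blast
  next
    assume "\<exists>A. analytic_mat (\<lambda>z. \<psi> z - \<phi> (cnj z) ** A) \<and>
        analytic_mat (\<lambda>z. \<psi> z + A ** conj_transpose (\<phi> z)) \<and>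
        analytic_mat (\<lambda>z. \<phi> (cnj z) ** A ** conj_transpose (\<phi> z))"
    then obtain A where 1: "analytic_mat (\<lambda>z. \<psi> z - \<phi> (cnj z) ** A)"
      and 2: "analytic_mat (\<lambda>z. \<psi> z + A ** conj_transpose (\<phi> z))"
      and 3: "analytic_mat (\<lambda>z. \<phi> (cnj z) ** A ** conj_transpose (\<phi> z))" by blast
    show "\<forall>h\<in>H2_vec. AE z in circle. ?L h z = ?R h z"
    proof
      fix h :: "complex \<Rightarrow> complex^'n" assume h: "h \<in> H2_vec"
      show "AE z in circle. ?L h z = ?R h z"
      proof (rule L2_vec_eq_AE)
        show "?L h \<in> L2_vec" "?R h \<in> L2_vec" using in_H2[OF h] by (auto simp: H2_vec_iff)
        \<comment> \<open>For \<open>k >= 0\<close> the defect is the coefficient at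
          \<open>- k - 1\<close> of an analytic matrix applied to \<open>h\<close>, hence 0 by
          (iii); for \<open>k < 0\<close> both sides lie in \<open>H2_vec\<close> and
          vanish.\<close>
        show "vcoeff (?L h) k = vcoeff (?R h) k" for k
        proof (cases "k \<ge> 0")
          case True
          then show ?thesis
            using intertwining_defect[OF phi psi h 1 2, of k] vcoeff_analytic_mult[OF L2 3 h, of "- k - 1"]
            by simp
        qed (use in_H2[OF h] in \<open>simp add: H2_vec_iff\<close>)
      qed
    qed
  qed
qed

end
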